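(* Let $\Omega$ be a Lebesgue measurable subset of $\mathbb{R}^N$ of finite Lebesgue measure such that there exist $D<-N$, $\alpha>0$, and $G\colon\mathbb{R}\to(0,+\infty)$, a nonconstant periodic function with period $T>0$, satisfying $$|{}_t\Omega|=t^{N+D}\bigl(G(\log t)+O(t^{-\alpha})\bigr)\quad\text{as }t\to+\infty.$$ Then: (1) $G$ is continuous, $\dim_B(\infty,\Omega)$ exists and $\dim_B(\infty,\Omega)=D$. Furthermore, $\Omega$ is Minkowski nondegenerate at infinity with $\underline{\mathcal M}^D(\infty,\Omega)=\min G$ and $\overline{\mathcal M}^D(\infty,\Omega)=\max G$. (Hence the range of $G|_{[0,T]}$ is the interval $[\underline{\mathcal M}^D(\infty,\Omega),\overline{\mathcal M}^D(\infty,\Omega)]$.) (2) The tube zeta function $\widetilde\zeta_{\infty,\Omega}$ has abscissa of convergence $D(\widetilde\zeta_{\infty,\Omega})=D$ and possesses a unique meromorphic extension (still denoted by $\widetilde\zeta_{\infty,\Omega}$) to (at least) the half-plane $\{\operatorname{Re}s>D-\alpha\}$. The set of all poles of $\widetilde\zeta_{\infty,\Omega}$ in this half-plane is $$\mathcal P_\alpha(\widetilde\zeta_{\infty,\Omega})=\left\{s_k=D+\frac{2\pi}{T}\,i\,k:\hat G_0\!\left(\frac kT\right)\ne0,\ k\in\mathbb{Z}\right\};$$ they are all simple, and the residue at each $s_k\in\mathcal P_\alpha(\widetilde\zeta_{\infty,\Omega})$, $k\in\mathbb{Z}$, is $$\operatorname{res}(\widetilde\zeta_{\infty,\Omega},s_k)=\frac1T\hat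 G_0\!\left(\frac kT\right).$$ (3) If $s_k\in\mathcal P_\alpha(\widetilde\zeta_{\infty,\Omega})$, then $s_{-k}\in\mathcal P_\alpha(\widetilde\zeta_{\infty,\Omega})$, and $$|\operatorname{res}(\widetilde\zeta_{\infty,\Omega},s_k)|\le\frac1T\int_0^TG(\tau)\,d\tau,\qquad\lim_{k\to\pm\infty}\operatorname{res}(\widetilde\zeta_{\infty,\Omega},s_k)=0.$$ (4) The set $\mathcal P_\alpha(\widetilde\zeta_{\infty,\Omega})$ contains $s_0=D$, and $$\operatorname{res}(\widetilde\zeta_{\infty,\Omega},D)=\frac1T\int_0^TG(\tau)\,d\tau.$$ In particular, $\Omega$ is not Minkowski measurable at infinity and $$\underline{\mathcal M}^D(\infty,\Omega)<\operatorname{res}(\widetilde\zeta_{\infty,\Omega},D)<\overline{\mathcal M}^D(\infty,\Omega)<\infty.$$ (5) If, in addition, $G\in C^m(\mathbb{R})$ (i.e., $G$ is $m$ times continuously differentiable on $\mathbb{R}$) for some integer $m\ge1$, and $G$ has an extremum $t_0$ such that $G'(t_0)=G''(t_0)=\dots=G^{(m)}(t_0)=0$, then there exists $C_m>0$ such that for all $k\in\mathbb{Z}\setminus\{0\}$ with $s_k\in\mathcal P_\alpha(\widetilde\zeta_{\infty,\Omega})$ we have $$|\operatorname{res}(\widetilde\zeta_{\infty,\Omega},s_k)|\le C_m|k|^{-m}.$$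
   Context: $|\cdot|$ denotes $N$-dimensional Lebesgue measure for sets. For $t>0$, ${}_t\Omega:=B_t(0)^c\cap\Omega$, where $B_t(0)$ is the open Euclidean ball of radius $t$ centered at $0$. For $r\in\mathbb{R}$, the upper and lower $r$-dimensional Minkowski contents of $\Omega$ at infinity, $\overline{\mathcal M}^r(\infty,\Omega)$ and $\underline{\mathcal M}^r(\infty,\Omega)$, are the $\limsup$ and $\liminf$ of $|{}_t\Omega|/t^{N+r}$ as $t\to+\infty$. The upper (lower) Minkowski dimension at infinity is the infimum of all $r\in\mathbb{R}$ for which the upper (lower) $r$-dimensional content is $0$; if both coincide the common value is $\dim_B(\infty,\Omega)$. $\Omega$ is Minkowski nondegenerate at infinity if $0<\underline{\mathcal M}^D(\infty,\Omega)\le\overline{\mathcal M}^D(\infty,\Omega)<\infty$ for some $D\in\mathbb{R}$ (necessarily $D=\dim_B(\infty,\Omega)$), and Minkowski measurable at infinity if moreover these two contents are equal. The tube zeta function at infinity is $\widetilde\zeta_{\infty,\Omega}(s):=\int_P^{+\infty}t^{-s-N-1}|{}_t\Omega|\,dt$ for a fixed $P>0$ (changing $P$ only adds an entire function). Its abscissa of convergence $D(\widetilde\zeta_{\infty,\Omega})$ is the infimum of all $\sigma\in\mathbb{R}$ such that this integral converges absolutely for all $s$ with $\operatorname{Re}s>\sigma$. $\operatorname{res}(f,\omega)$ is the residue of $f$ at $\omega$ (equal to $0$ if $f$ is holomorphic at $\omega$). $G_0(\tau):=\chi_{[0,T]}(\tau)G(\tau)$, where $\chi_{[0,T]}$ is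 the characteristic function of $[0,T]$ and $T$ is the minimal period of $G$; the Fourier transform is $\hat G_0(s):=\int_{-\infty}^{+\infty}e^{-2\pi i s\tau}G_0(\tau)\,d\tau$. *)

theory Defs
  imports
    "HOL-Library.Landau_Symbols"
    "HOL-Complex_Analysis.Complex_Analysis"
begin

definition tail_at :: "real \<Rightarrow> 'a::euclidean_space set \<Rightarrow> 'a set" where
  "tail_at t \<Omega> = (- ball 0 t) \<inter> \<Omega>"


subsection \<open>Minkowski contents and dimension at infinity\<close>

text \<open>Contents take values in \<^typ>\<open>ennreal\<close>, so that they may be infinite; dimensions are infima in
  the extended reals, so that the infimum of the empty set is infinity.\<close>

definition upper_Minkowski_content :: "real \<Rightarrow> 'a::euclidean_space set \<Rightarrow> ennreal" where
  "upper_Minkowski_content r \<Omega> =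
     Limsup at_top (\<lambda>t. emeasure lebesgue (tail_at t \<Omega>) / ennreal (t powr (real DIM('a) + r)))"

definition lower_Minkowski_content :: "real \<Rightarrow> 'a::euclidean_space set \<Rightarrow> ennreal" where
  "lower_Minkowski_content r \<Omega> =
     Liminf at_top (\<lambda>t. emeasure lebesgue (tail_at t \<Omega>) / ennreal (t powr (real DIM('a) + r)))"

definition upper_Minkowski_dim :: "'a::euclidean_space set \<Rightarrow> ereal" where
  "upper_Minkowski_dim \<Omega> = Inf (ereal ` {r. upper_Minkowski_content r \<Omega> = 0})"

definition lower_Minkowski_dim :: "'a::euclidean_space set \<Rightarrow> ereal" where
  "lower_Minkowski_dim \<Omega> = Inf (ereal ` {r. lower_Minkowski_content r \<Omega> = 0})"

definition has_Minkowski_dim :: "'a::euclidean_space set \<Rightarrow> ereal \<Rightarrow> bool" where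
  "has_Minkowski_dim \<Omega> d \<longleftrightarrow> upper_Minkowski_dim \<Omega> = d \<and> lower_Minkowski_dim \<Omega> = d"

definition Minkowski_nondegenerate :: "'a::euclidean_space set \<Rightarrow> bool" where
  "Minkowski_nondegenerate \<Omega> \<longleftrightarrow>
     (\<exists>D. 0 < lower_Minkowski_content D \<Omega> \<and>
          lower_Minkowski_content D \<Omega> \<le> upper_Minkowski_content D \<Omega> \<and>
          upper_Minkowski_content D \<Omega> < \<infinity>)"

definition Minkowski_measurable :: "'a::euclidean_space set \<Rightarrow> bool" where
  "Minkowski_measurable \<Omega> \<longleftrightarrow>
     (\<exists>D. 0 < lower_Minkowski_content D \<Omega> \<and>
          lower_Minkowski_content D \<Omega> = upper_Minkowski_content D \<Omega> \<and>
          upper_Minkowski_content D \<Omega> < \<infinity>)"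


subsection \<open>The tube zeta function at infinity\<close>

text \<open>The real-valued \<^const>\<open>measure\<close> is used in the integrand, so this is meaningful only if the
  tails of \<open>\<Omega>\<close> have finite measure.\<close>

definition tube_zeta_integrand :: "'a::euclidean_space set \<Rightarrow> complex \<Rightarrow> real \<Rightarrow> complex" where
  "tube_zeta_integrand \<Omega> s t =
     of_real t powr (- s - of_nat DIM('a) - 1) * of_real (measure lebesgue (tail_at t \<Omega>))"

definition tube_zeta :: "real \<Rightarrow> 'a::euclidean_space set \<Rightarrow> complex \<Rightarrow> complex" where
  "tube_zeta P \<Omega> s = (LINT t:{P..}|lborel. tube_zeta_integrand \<Omega> s t)"

definition tube_zeta_abscissa :: "real \<Rightarrow> 'a::euclidean_space set \<Rightarrow> ereal" where
  "tube_zeta_abscissa P \<Omega> =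
     Inf (ereal ` {\<sigma>. \<forall>s. \<sigma> < Re s \<longrightarrow> set_integrable lborel {P..} (tube_zeta_integrand \<Omega> s)})"

text \<open>\<open>nicely_meromorphic_on\<close> makes the function continuous at each point that is not a pole and \<open>0\<close> at
  the poles, so an extension to a connected open set is unique as a function on that set.\<close>

definition is_meromorphic_extension ::
    "(complex \<Rightarrow> complex) \<Rightarrow> complex set \<Rightarrow> (complex \<Rightarrow> complex) \<Rightarrow> complex set \<Rightarrow> bool" where
  "is_meromorphic_extension f A Z U \<longleftrightarrow>
     A \<subseteq> U \<and> Z nicely_meromorphic_on U \<and> (\<forall>s\<in>A. Z s = f s)"

definition poles_in :: "(complex \<Rightarrow> complex) \<Rightarrow> complex set \<Rightarrow> complex set" where
  "poles_in f U = {s \<in> U. is_pole f s}"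


subsection \<open>The periodic function\<close>

definition is_minimal_period :: "(real \<Rightarrow> real) \<Rightarrow> real \<Rightarrow> bool" where
  "is_minimal_period G T \<longleftrightarrow>
     T > 0 \<and> (\<forall>\<tau>. G (\<tau> + T) = G \<tau>) \<and>
     (\<forall>T'. 0 < T' \<and> (\<forall>\<tau>. G (\<tau> + T') = G \<tau>) \<longrightarrow> T \<le> T')"

definition truncated :: "real \<Rightarrow> (real \<Rightarrow> real) \<Rightarrow> real \<Rightarrow> real" where
  "truncated T G \<tau> = indicator {0..T} \<tau> * G \<tau>"

definition Fourier :: "(real \<Rightarrow> real) \<Rightarrow> complex \<Rightarrow> complex" where
  "Fourier f s = (LINT \<tau>|lborel. exp (- 2 * of_real pi * \<i> * s * of_real \<tau>) * of_real (f \<tau>))"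

definition has_minimum :: "(real \<Rightarrow> real) \<Rightarrow> real \<Rightarrow> bool" where
  "has_minimum f m \<longleftrightarrow> m \<in> range f \<and> (\<forall>x. m \<le> f x)"

definition has_maximum :: "(real \<Rightarrow> real) \<Rightarrow> real \<Rightarrow> bool" where
  "has_maximum f M \<longleftrightarrow> M \<in> range f \<and> (\<forall>x. f x \<le> M)"

definition C_class :: "nat \<Rightarrow> (real \<Rightarrow> real) \<Rightarrow> bool" where
  "C_class m f \<longleftrightarrow>
     (\<forall>j<m. (deriv ^^ j) f differentiable_on UNIV) \<and> continuous_on UNIV ((deriv ^^ m) f)"

definition local_extremum_at :: "(real \<Rightarrow> real) \<Rightarrow> real \<Rightarrow> bool" where
  "local_extremum_at f x0 \<longleftrightarrow>
     (\<forall>\<^sub>F x in nhds x0. f x \<le> f x0) \<or> (\<forall>\<^sub>F x in nhds x0. f x0 \<le> f x)"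

definition lattice_point :: "real \<Rightarrow> real \<Rightarrow> int \<Rightarrow> complex" where
  "lattice_point D T k = of_real D + of_real (2 * pi / T) * \<i> * of_int k"

end

theory Submission
  imports Defs
begin

text \<open>Write \<open>V t\<close> for the volume of \<open>tail_at t \<Omega>\<close> and \<open>N\<close> for the dimension of the space. The
hypothesis says that \<open>V t / t powr (N + D)\<close> approaches the function \<open>G (ln t)\<close>, which is periodic in
the logarithmic scale.

The geometric part only uses this limit. Along the geometric progression \<open>exp (x + n * T)\<close> the
normalised volume tends to \<open>G x\<close>, locally uniformly in \<open>x\<close>; since \<open>V\<close> is continuous (spheres are
null sets), so is \<open>G\<close> (\<open>log_periodic_limit_continuous\<close>). The same progressions show that \<open>max G\<close> and
\<open>min G\<close> are the upper and the lower content of order \<open>D\<close> (\<open>Limsup_log_periodic\<close>,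
\<open>Liminf_log_periodic\<close>). As both are positive and finite, the contents of any other order are \<open>0\<close> or
infinity, which gives the dimension and excludes measurability in another order.

For the zeta function, \<open>V\<close> is split into its leading part \<open>t powr (N + D) * G (ln t)\<close> and a remainder
of order \<open>t powr (N + D - \<alpha>)\<close>. The Mellin transform of the remainder is holomorphic for
\<open>Re s > D - \<alpha>\<close> (\<open>holomorphic_tail_Mellin\<close>). The leading part is multiplied by \<open>exp ((N + D) * T)\<close>
when \<open>t\<close> is multiplied by \<open>exp T\<close>, so that its transform, as a geometric series, equals
\<open>F s / (1 - exp (- T * (s - D)))\<close>, where the entire function \<open>F\<close> is an integral over a single period
(\<open>log_periodic_tail_Mellin\<close>). The only possible poles are the simple zeros \<open>s\<^sub>k = D + 2 * pi * \<i> * k / T\<close>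
of the denominator, whose derivative there is \<open>T\<close>. Since the integrand of \<open>F s\<^sub>k\<close> is periodic, \<open>F s\<^sub>k\<close>
is the Fourier integral of \<open>G\<close> over \<open>[0, T]\<close>; hence \<open>s\<^sub>k\<close> is a pole iff this integral is nonzero, and
the residue is the integral divided by \<open>T\<close> (\<open>lattice_quotient_meromorphic\<close>).

Everything else is Fourier analysis on one period: the residues tend to \<open>0\<close> by the Riemann-Lebesgue
lemma, integration by parts makes them decay like \<open>k powi (- m)\<close> for \<open>G\<close> of class \<open>C\<^sup>m\<close>, and the
residue at \<open>D\<close> is the mean of \<open>G\<close>, which lies strictly between the extrema of a nonconstant
continuous function.\<close>

section \<open>Periodic functions and their Fourier integrals\<close>

lemma periodic_add_int:
  fixes f :: "real \<Rightarrow> 'b"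
  assumes per: "\<And>x. f (x + T) = f x"
  shows "f (x + of_int n * T) = f x"
proof -
  have nat: "f (x + of_nat k * T) = f x" for k x
  proof (induction k)
    case (Suc k)
    have "f (x + of_nat (Suc k) * T) = f ((x + of_nat k * T) + T)"
      by (simp add: algebra_simps)
    with Suc show ?case by (simp only: per)
  qed simp
  show ?thesis
  proof (cases "n \<ge> 0")
    case True
    then show ?thesis using nat[of x "nat n"] by simp
  next
    case False
    then show ?thesis using nat[of "x + of_int n * T" "nat (- n)"] by simp
  qed
qed

lemma periodic_representative:
  fixes f :: "real \<Rightarrow> 'b"
  assumes per: "\<And>x. f (x + T) = f x" and T: "T > 0"
  obtains y where "y \<in> {0..T}" "f y = f x"
proof
  have "f (x + of_int (- \<lfloor>x / T\<rfloor>) * T) = f x"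
    using periodic_add_int[of f T x, OF per] .
  then show "f (x - of_int \<lfloor>x / T\<rfloor> * T) = f x"
    by simp
  have "of_int \<lfloor>x / T\<rfloor> * T \<le> x" "x \<le> (of_int \<lfloor>x / T\<rfloor> + 1) * T"
    using floor_divide_lower[OF T, of x] floor_divide_upper[OF T, of x] by simp_all
  then show "x - of_int \<lfloor>x / T\<rfloor> * T \<in> {0..T}"
    by (simp add: algebra_simps)
qed

lemma integral_over_period:
  fixes f :: "real \<Rightarrow> 'b::euclidean_space"
  assumes per: "\<And>x. f (x + T) = f x" and T: "T > 0" and cont: "continuous_on UNIV f"
  shows "integral {a..a + T} f = integral {0..T} f"
proof -
  note cont' = continuous_on_subset[OF cont subset_UNIV]
  note int = integrable_continuous_real[OF cont']
  define n where "n = \<lfloor>a / T\<rfloor>"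
  define b where "b = a - of_int n * T"
  have b: "0 \<le> b" "b \<le> T"
    using floor_divide_lower[OF T, of a] floor_divide_upper[OF T, of a]
    unfolding b_def n_def by (simp_all add: algebra_simps)
  have shift: "integral {x + of_int k * T..y + of_int k * T} f = integral {x..y} f" for x y k
    using integral_shift[of x "of_int k * T" y f, OF cont'] periodic_add_int[of f, OF per]
    by (simp add: o_def)
  have "integral {a..a + T} f = integral {b..b + T} f"
    using shift[of b n "b + T"] by (simp add: b_def algebra_simps)
  also have "\<dots> = integral {b..T} f + integral {T..b + T} f"
    using b int by (intro Henstock_Kurzweil_Integration.integral_combine[symmetric]) auto
  also have "integral {T..b + T} f = integral {0..b} f"
    using shift[of 0 1 b] by simp
  also have "integral {b..T} f + integral {0..b} f = integral {0..T} f"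
    using b int Henstock_Kurzweil_Integration.integral_combine[of 0 b T f]
    by (simp add: add.commute)
  finally show ?thesis .
qed

lemma periodic_range_interval:
  fixes f :: "real \<Rightarrow> real"
  assumes per: "\<And>x. f (x + T) = f x" and T: "T > 0" and cont: "continuous_on UNIV f"
  obtains m M where "has_minimum f m" "has_maximum f M" "f ` {0..T} = {m..M}"
proof -
  have "connected (f ` {0..T})" "compact (f ` {0..T})"
    using cont by (auto intro!: connected_continuous_image compact_continuous_image
        intro: continuous_on_subset)
  then obtain m M where mM: "f ` {0..T} = {m..M}"
    by (metis connected_compact_interval_1)
  have ne: "f ` {0..T} \<noteq> {}" using T by auto
  have in_range: "f x \<in> {m..M}" for x
  proof -
    obtain y where "y \<in> {0..T}" "f y = f x"
      by (rule periodic_representative[of f, OF per T])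
    then show ?thesis using mM by (metis imageI)
  qed
  have "m \<in> f ` {0..T}" "M \<in> f ` {0..T}"
    using ne unfolding mM by auto
  then show ?thesis
    using that[OF _ _ mM] in_range by (auto simp: has_minimum_def has_maximum_def)
qed

text \<open>The integral of the nonnegative continuous function \<open>M - f\<close> can only vanish if \<open>f\<close> is identically \<open>M\<close>.\<close>

lemma continuous_mean_less:
  fixes f :: "real \<Rightarrow> real"
  assumes T: "T > 0" and cont: "continuous_on {0..T} f"
    and le: "\<And>x. x \<in> {0..T} \<Longrightarrow> f x \<le> M" and x: "x \<in> {0..T}" "f x \<noteq> M"
  shows "1 / T * integral {0..T} f < M"
proof -
  have int: "f integrable_on {0..T}"
    using cont by (rule integrable_continuous_real)
  have eq: "integral {0..T} (\<lambda>x. M - f x) = T * M - integral {0..T} f"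
    using T int by (subst Henstock_Kurzweil_Integration.integral_diff) auto
  have "integral {0..T} (\<lambda>x. M - f x) \<ge> 0"
    using le by (intro integral_nonneg integrable_diff int) auto
  moreover have "integral {0..T} (\<lambda>x. M - f x) \<noteq> 0"
  proof
    assume "integral {0..T} (\<lambda>x. M - f x) = 0"
    then have "((\<lambda>x. M - f x) has_integral 0) (cbox 0 T)"
      using integrable_integral[OF integrable_diff[OF integrable_const_ivl[of M] int]] by simp
    then have "M - f x = 0"
      by (rule has_integral_0_cbox_imp_0[rotated 2])
         (use T cont le x in \<open>auto intro!: continuous_intros\<close>)
    with x show False by simp
  qed
  ultimately show ?thesis
    using T unfolding eq by (simp add: field_simps)
qed

lemma continuous_mean_greater:
  fixes f :: "real \<Rightarrow> real"
  assumes "T > 0" "continuous_on {0..T} f"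
    "\<And>x. x \<in> {0..T} \<Longrightarrow> m \<le> f x" "x \<in> {0..T}" "f x \<noteq> m"
  shows "m < 1 / T * integral {0..T} f"
  using continuous_mean_less[of T "\<lambda>x. - f x" "- m" x] assms
  by (auto intro!: continuous_intros)

text \<open>The values \<open>s\<close> at which \<open>exp (- s * x)\<close> has period \<open>T\<close> in \<open>x\<close>; \<open>lattice_point D T k\<close> is the translate
of \<open>frequency T k\<close> by \<open>D\<close>.\<close>

definition frequency :: "real \<Rightarrow> int \<Rightarrow> complex" where
  "frequency T k = of_real (2 * pi / T) * \<i> * of_int k"

definition Fourier_integral :: "real \<Rightarrow> (real \<Rightarrow> complex) \<Rightarrow> int \<Rightarrow> complex" where
  "Fourier_integral T f k = integral {0..T} (\<lambda>x. exp (- frequency T k * of_real x) * f x)"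

lemma exp_frequency_period:
  assumes "T \<noteq> 0"
  shows "exp (- frequency T k * of_real (x + T)) = exp (- frequency T k * of_real x)"
proof -
  have "- frequency T k * of_real (x + T) =
      - frequency T k * of_real x + \<i> * (of_int (- k) * (of_real pi * 2))"
    using assms by (simp add: frequency_def field_simps)
  then show ?thesis
    by (simp only: exp_plus_2pin)
qed

lemma norm_exp_frequency: "norm (exp (- (frequency T k * of_real x))) = 1"
  by (simp add: frequency_def)

lemma Fourier_integrand_integrable:
  assumes "continuous_on UNIV f"
  shows "(\<lambda>x. exp (- frequency T k * of_real x) * f x) integrable_on {a..b}"
  using assms by (intro integrable_continuous_real continuous_intros) (auto intro: continuous_on_subset)

lemma norm_Fourier_integral_le:
  assumes "continuous_on UNIV f"
  shows "norm (Fourier_integral T f k) \<le> integral {0..T} (\<lambda>x. norm (f x))"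
  unfolding Fourier_integral_def
  using assms
  by (intro integral_norm_bound_integral Fourier_integrand_integrable
      integrable_continuous_real continuous_intros)
     (auto simp: norm_mult frequency_def intro: continuous_on_subset)

lemma Fourier_integral_over_period:
  assumes "\<And>x. f (x + T) = f x" "T > 0" "continuous_on UNIV f"
  shows "integral {a..a + T} (\<lambda>x. exp (- frequency T k * of_real x) * f x) = Fourier_integral T f k"
  unfolding Fourier_integral_def
  using assms exp_frequency_period[of T k]
  by (intro integral_over_period continuous_intros) simp_all

text \<open>Translation by half a period of the \<open>k\<close>-th character changes the sign of that character. Averaging the
Fourier integral with its translate therefore replaces \<open>f\<close> by a difference over a distance of order
\<open>1 / k\<close>.\<close>

lemma Fourier_integral_half_shift:
  assumes per: "\<And>x. f (x + T) = f x" and T: "T > 0" and cont: "continuous_on UNIV f" and k: "k \<noteq> 0"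
  shows "2 * Fourier_integral T f k =
    integral {0..T} (\<lambda>x. exp (- frequency T k * of_real x) * (f x - f (x + T / (2 * of_int k))))"
proof -
  define h where "h = T / (2 * of_int k)"
  define g where "g = (\<lambda>x. exp (- frequency T k * of_real x) * f x)"
  note cont' = continuous_on_subset[OF cont subset_UNIV]
  have gcont: "continuous_on A g" for A
    unfolding g_def by (intro continuous_intros cont')
  have half: "exp (- frequency T k * of_real (x + h)) = - exp (- frequency T k * of_real x)" for x
  proof -
    have "- frequency T k * of_real (x + h) = - frequency T k * of_real x - of_real pi * \<i>"
      using T k by (simp add: frequency_def h_def field_simps)
    then show ?thesis
      by (simp only: exp_diff) simp
  qed
  have "Fourier_integral T f k = integral {h..h + T} g"
    using Fourier_integral_over_period[OF per T cont, of h k] by (simp add: g_def)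
  also have "\<dots> = integral {0..T} (\<lambda>x. g (x + h))"
    using integral_shift[of 0 h T g, OF gcont] by (simp add: o_def add.commute)
  finally have 1: "Fourier_integral T f k = integral {0..T} (\<lambda>x. g (x + h))" .
  have "2 * Fourier_integral T f k = integral {0..T} g + integral {0..T} (\<lambda>x. g (x + h))"
    using 1 by (simp add: Fourier_integral_def g_def)
  also have "\<dots> = integral {0..T} (\<lambda>x. g x + g (x + h))"
    by (intro Henstock_Kurzweil_Integration.integral_add[symmetric] integrable_continuous_real gcont
        continuous_on_compose2[OF gcont[of UNIV]] continuous_intros) auto
  also have "(\<lambda>x. g x + g (x + h)) = (\<lambda>x. exp (- frequency T k * of_real x) * (f x - f (x + h)))"
    unfolding g_def half by (simp add: algebra_simps)
  finally show ?thesis by (simp add: h_def)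
qed

text \<open>A continuous periodic function is uniformly continuous, so the differences in
\<open>Fourier_integral_half_shift\<close> are uniformly small when \<open>k\<close> is large.\<close>

lemma Riemann_Lebesgue_periodic:
  assumes per: "\<And>x. f (x + T) = f x" and T: "T > 0" and cont: "continuous_on UNIV f"
  shows "((\<lambda>k. Fourier_integral T f k) \<longlongrightarrow> 0) at_top" "((\<lambda>k. Fourier_integral T f k) \<longlongrightarrow> 0) at_bot"
proof -
  have key: "\<exists>K>0. \<forall>k. \<bar>k\<bar> \<ge> K \<longrightarrow> norm (Fourier_integral T f k) < e" if e: "e > 0" for e
  proof -
    \<comment> \<open>One period on each side of \<open>{0..T}\<close> leaves room for every shift \<open>h\<close> with \<open>\<bar>h\<bar> \<le> T\<close>.\<close>
    have "uniformly_continuous_on {- T..2 * T} f"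
      by (intro compact_uniformly_continuous continuous_on_subset[OF cont]) auto
    then obtain d where d: "d > 0"
      and ud: "\<And>x y. x \<in> {- T..2 * T} \<Longrightarrow> y \<in> {- T..2 * T} \<Longrightarrow> dist y x < d \<Longrightarrow> dist (f y) (f x) < e / T"
      using divide_pos_pos[OF e T] unfolding uniformly_continuous_on_def by blast
    obtain K0 :: int where K0: "T / d < of_int K0"
      using ex_less_of_int by blast
    have "norm (Fourier_integral T f k) < e" if k: "\<bar>k\<bar> \<ge> max 1 K0" for k
    proof -
      define h where "h = T / (2 * of_int k)"
      have k1: "\<bar>real_of_int k\<bar> \<ge> 1" and kK: "\<bar>real_of_int k\<bar> \<ge> of_int K0"
        using k by linarith+
      have habs: "\<bar>h\<bar> = T / (2 * \<bar>real_of_int k\<bar>)"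
        using T by (simp add: h_def abs_mult)
      have "\<bar>h\<bar> \<le> T"
        using k1 T unfolding habs by (simp add: field_simps mult_left_le)
      have "T / d < 2 * \<bar>real_of_int k\<bar>"
        using K0 kK k1 by linarith
      then have hd: "\<bar>h\<bar> < d"
        using k1 T d unfolding habs by (simp add: field_simps)
      have "k \<noteq> 0" using k1 by auto
      have "norm (2 * Fourier_integral T f k) \<le> integral {0..T} (\<lambda>x. e / T)"
        unfolding Fourier_integral_half_shift[OF per T cont \<open>k \<noteq> 0\<close>, folded h_def]
      proof (rule integral_norm_bound_integral)
        fix x assume x: "x \<in> {0..T}"
        have "dist (f x) (f (x + h)) < e / T"
          using x \<open>\<bar>h\<bar> \<le> T\<close> hd T by (intro ud) (auto simp: dist_real_def)
        then show "norm (exp (- frequency T k * of_real x) * (f x - f (x + h))) \<le> e / T"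
          by (simp add: norm_mult norm_exp_frequency dist_norm del: norm_exp_eq_Re)
      qed (auto intro!: integrable_continuous_real continuous_intros
            continuous_on_compose2[OF cont] continuous_on_subset[OF cont])
      then show ?thesis using T e by (simp add: norm_mult)
    qed
    then show ?thesis
      by (intro exI[of _ "max 1 K0"]) auto
  qed
  show "((\<lambda>k. Fourier_integral T f k) \<longlongrightarrow> 0) at_top"
    unfolding tendsto_iff eventually_at_top_linorder
    by (metis key abs_ge_self dist_0_norm dist_commute order_trans)
  show "((\<lambda>k. Fourier_integral T f k) \<longlongrightarrow> 0) at_bot"
    unfolding tendsto_iff eventually_at_bot_linorder
  proof (intro allI impI)
    fix e :: real assume "e > 0"
    then obtain K where K: "\<forall>k. \<bar>k\<bar> \<ge> K \<longrightarrow> norm (Fourier_integral T f k) < e"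
      using key by blast
    show "\<exists>N. \<forall>k\<le>N. dist (Fourier_integral T f k) 0 < e"
      by (rule exI[of _ "- K"]) (use K in auto)
  qed
qed

text \<open>Integration by parts; the boundary terms cancel because character and function both have period \<open>T\<close>.\<close>

lemma Fourier_integral_deriv:
  assumes per: "\<And>x. f (x + T) = f x" and T: "T > 0"
    and deriv: "\<And>x. (f has_vector_derivative f' x) (at x)" and cont: "continuous_on UNIV f'"
  shows "Fourier_integral T f' k = frequency T k * Fourier_integral T f k"
proof -
  let ?e = "\<lambda>x::real. exp (- frequency T k * of_real x)"
  have contf: "continuous_on UNIV f"
    using deriv by (meson continuous_at_imp_continuous_on has_vector_derivative_continuous)
  have "((\<lambda>x. ?e x * f x) has_vector_derivative (?e x * f' x - frequency T k * (?e x * f x))) (at x)" for x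
    by (rule has_vector_derivative_eq_rhs, rule has_vector_derivative_mult[OF _ deriv])
       (auto intro!: derivative_eq_intros has_vector_derivative_real_field simp: algebra_simps)
  then have "((\<lambda>x. ?e x * f' x - frequency T k * (?e x * f x)) has_integral
      (?e T * f T - ?e 0 * f 0)) {0..T}"
    using T by (intro fundamental_theorem_of_calculus) (auto intro: has_vector_derivative_at_within)
  moreover have "?e T * f T = ?e 0 * f 0"
    using exp_frequency_period[of T k 0] per[of 0] T by simp
  ultimately have "integral {0..T} (\<lambda>x. ?e x * f' x - frequency T k * (?e x * f x)) = 0"
    by (simp add: integral_unique)
  then show ?thesis
    unfolding Fourier_integral_def
    by (subst (asm) Henstock_Kurzweil_Integration.integral_diff)
       (use Fourier_integrand_integrable[OF cont, of T k 0 T] Fourier_integrand_integrable[OF contf, of T k 0 T]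
         in \<open>auto intro!: integrable_on_mult_right\<close>)
qed

lemma deriv_periodic:
  fixes f :: "real \<Rightarrow> real"
  assumes per: "\<And>x. f (x + T) = f x"
  shows "deriv f (x + T) = deriv f x"
proof -
  have "(\<lambda>x. f (x + T)) = f" using per by auto
  then have "(f has_field_derivative D) (at (x + T)) \<longleftrightarrow> (f has_field_derivative D) (at x)" for D
    using DERIV_shift[of f D x T] by simp
  then show ?thesis by (simp add: deriv_def)
qed

lemma Fourier_integral_iterated_deriv:
  fixes f :: "real \<Rightarrow> real"
  assumes per: "\<And>x. f (x + T) = f x" and T: "T > 0" and C: "C_class m f"
  shows "Fourier_integral T (\<lambda>x. of_real ((deriv ^^ m) f x)) k =
    frequency T k ^ m * Fourier_integral T (\<lambda>x. of_real (f x)) k"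
proof -
  have diff: "(deriv ^^ j) f differentiable_on UNIV" if "j < m" for j
    using C that by (auto simp: C_class_def)
  have cont: "continuous_on UNIV ((deriv ^^ j) f)" if "j \<le> m" for j
    using C diff[of j] that
    by (cases "j = m") (auto simp: C_class_def intro: differentiable_imp_continuous_on)
  have perj: "(deriv ^^ j) f (x + T) = (deriv ^^ j) f x" for j x
    by (induction j arbitrary: x) (auto simp: per intro: deriv_periodic)
  have "j \<le> m \<Longrightarrow> Fourier_integral T (\<lambda>x. of_real ((deriv ^^ j) f x)) k =
    frequency T k ^ j * Fourier_integral T (\<lambda>x. of_real (f x)) k" for j
  proof (induction j)
    case (Suc j)
    have "((deriv ^^ j) f has_field_derivative (deriv ^^ Suc j) f x) (at x)" for x
      using diff[of j] Suc.prems
      by (simp add: differentiable_on_def real_differentiable_def DERIV_imp_deriv) (metis DERIV_imp_deriv)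
    then have "((\<lambda>x. complex_of_real ((deriv ^^ j) f x)) has_vector_derivative
        of_real ((deriv ^^ Suc j) f x)) (at x)" for x
      by (intro has_vector_derivative_of_real)
         (simp add: has_real_derivative_iff_has_vector_derivative)
    then have "Fourier_integral T (\<lambda>x. of_real ((deriv ^^ Suc j) f x)) k =
        frequency T k * Fourier_integral T (\<lambda>x. of_real ((deriv ^^ j) f x)) k"
      using cont[OF Suc.prems]
      by (intro Fourier_integral_deriv T continuous_on_of_real) (simp_all add: perj del: funpow.simps)
    with Suc show ?case by simp
  qed simp
  then show ?thesis by simp
qed

text \<open>After \<open>m\<close> integrations by parts the Fourier integral of the continuous \<open>m\<close>-th derivative is bounded in
\<open>k\<close>, while the factor gained is the \<open>m\<close>-th power of a multiple of \<open>k\<close>.\<close>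

lemma Fourier_integral_smooth_decay:
  fixes f :: "real \<Rightarrow> real"
  assumes per: "\<And>x. f (x + T) = f x" and T: "T > 0" and C: "C_class m f"
  obtains B where "B > 0"
    "\<And>k. k \<noteq> 0 \<Longrightarrow> norm (Fourier_integral T (\<lambda>x. of_real (f x)) k) \<le> B * \<bar>real_of_int k\<bar> powi (- int m)"
proof -
  define J where "J = integral {0..T} (\<lambda>x. \<bar>(deriv ^^ m) f x\<bar>)"
  have cont: "continuous_on UNIV ((deriv ^^ m) f)"
    using C by (simp add: C_class_def)
  \<comment> \<open>The integral \<open>J\<close> can vanish; \<open>J + 1\<close> makes the constant below positive.\<close>
  have J: "J \<ge> 0"
    unfolding J_def using cont
    by (intro integral_nonneg integrable_continuous_real continuous_intros)
       (auto intro: continuous_on_subset)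
  have "norm (Fourier_integral T (\<lambda>x. of_real (f x)) k)
      \<le> ((T / (2 * pi)) ^ m * (J + 1)) * \<bar>real_of_int k\<bar> powi (- int m)" if k: "k \<noteq> 0" for k
  proof -
    have "norm (frequency T k) ^ m * norm (Fourier_integral T (\<lambda>x. of_real (f x)) k) \<le> J"
      using norm_Fourier_integral_le[OF continuous_on_of_real[OF cont], of T k]
      unfolding Fourier_integral_iterated_deriv[OF per T C]
      by (simp add: norm_mult norm_power J_def)
    moreover have nf: "norm (frequency T k) = 2 * pi * \<bar>real_of_int k\<bar> / T"
      using T by (simp add: frequency_def norm_mult norm_divide)
    ultimately have "norm (Fourier_integral T (\<lambda>x. of_real (f x)) k) \<le> J / (2 * pi * \<bar>real_of_int k\<bar> / T) ^ m"
      using k T by (simp add: field_simps)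
    also have "\<dots> \<le> (J + 1) / (2 * pi * \<bar>real_of_int k\<bar> / T) ^ m"
      using k T by (intro divide_right_mono) auto
    also have "\<dots> = ((T / (2 * pi)) ^ m * (J + 1)) * \<bar>real_of_int k\<bar> powi (- int m)"
      using k T by (simp add: power_int_minus field_simps power_mult_distrib power_divide)
    finally show ?thesis .
  qed
  moreover have "(T / (2 * pi)) ^ m * (J + 1) > 0"
    using T J by simp
  ultimately show ?thesis using that by blast
qed

lemma Fourier_truncated_eq:
  fixes f :: "real \<Rightarrow> real"
  assumes T: "T > 0" and cont: "continuous_on UNIV f"
  shows "Fourier (truncated T f) (of_real (of_int k / T)) = Fourier_integral T (\<lambda>x. of_real (f x)) k"
proof -
  let ?g = "\<lambda>x. exp (- frequency T k * of_real x) * complex_of_real (f x)"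
  have "set_integrable lborel {0..T} ?g"
    by (intro borel_integrable_atLeastAtMost' continuous_intros) (rule continuous_on_subset[OF cont], simp)
  then have "(LINT x:{0..T}|lborel. ?g x) = Fourier_integral T (\<lambda>x. of_real (f x)) k"
    unfolding Fourier_integral_def by (rule set_borel_integral_eq_integral)
  moreover have "Fourier (truncated T f) (of_real (of_int k / T)) = (LINT x:{0..T}|lborel. ?g x)"
    unfolding Fourier_def truncated_def set_lebesgue_integral_def
    by (intro Bochner_Integration.integral_cong)
       (auto simp: frequency_def indicator_def field_simps)
  ultimately show ?thesis by simp
qed

lemma Fourier_integral_uminus:
  fixes f :: "real \<Rightarrow> real"
  shows "Fourier_integral T (\<lambda>x. of_real (f x)) (- k) = cnj (Fourier_integral T (\<lambda>x. of_real (f x)) k)"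
  unfolding Fourier_integral_def integral_cnj
  by (intro arg_cong[of _ _ "integral {0..T}"]) (auto simp: frequency_def exp_cnj)

lemma Fourier_integral_0:
  fixes f :: "real \<Rightarrow> real"
  assumes "continuous_on UNIV f"
  shows "Fourier_integral T (\<lambda>x. of_real (f x)) 0 = of_real (integral {0..T} f)"
  unfolding Fourier_integral_def frequency_def
  using integrable_continuous_real[OF continuous_on_subset[OF assms subset_UNIV], of 0 T]
  by (simp add: integral_unique[OF has_integral_of_real[OF integrable_integral]])

section \<open>Mellin transforms of tails\<close>

text \<open>The exponent is normalised so that the transform of \<open>t powr c\<close> converges exactly for \<open>Re s > c\<close>.\<close>

definition Mellin_kernel :: "(real \<Rightarrow> real) \<Rightarrow> complex \<Rightarrow> real \<Rightarrow> complex" where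
  "Mellin_kernel f s t = of_real t powr (- s - 1) * of_real (f t)"

definition tail_Mellin :: "real \<Rightarrow> (real \<Rightarrow> real) \<Rightarrow> complex \<Rightarrow> complex" where
  "tail_Mellin b f s = (LINT t:{b..}|lborel. Mellin_kernel f s t)"

lemma Mellin_kernel_exp:
  assumes "t > 0"
  shows "Mellin_kernel f s t = exp (- (s + 1) * of_real (ln t)) * of_real (f t)"
proof -
  have "- s - 1 = - (s + 1)" by simp
  then show ?thesis
    using assms by (simp only: Mellin_kernel_def powr_def) (simp add: Ln_of_real)
qed

lemma norm_Mellin_kernel:
  assumes "t > 0"
  shows "norm (Mellin_kernel f s t) = t powr (- Re s - 1) * \<bar>f t\<bar>"
  using assms by (simp add: Mellin_kernel_def norm_mult norm_powr_real_powr)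

lemma continuous_on_Mellin_kernel:
  assumes "continuous_on A f" "A \<subseteq> {0<..}"
  shows "continuous_on A (Mellin_kernel f s)"
proof -
  have "continuous_on A (\<lambda>t. exp (- (s + 1) * of_real (ln t)) * of_real (f t))"
    using assms by (intro continuous_intros) auto
  then show ?thesis
    using assms(2) by (subst continuous_on_cong[OF refl Mellin_kernel_exp]) auto
qed

lemma set_integrable_powr_tail:
  fixes e b :: real
  assumes "e < -1" "b > 0"
  shows "set_integrable lborel {b..} (\<lambda>t. t powr e)"
proof -
  have "(\<lambda>t. t powr e) absolutely_integrable_on {b..}"
    using has_integral_powr_to_inf[OF assms]
    by (subst absolutely_integrable_on_iff_nonneg) (auto simp: has_integral_integrable)
  moreover have "(\<lambda>t. indicat_real {b..} t *\<^sub>R (t powr e)) \<in> borel_measurable borel"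
    using assms by (intro borel_measurable_continuous_on_indicator continuous_intros) auto
  ultimately show ?thesis
    unfolding set_integrable_def by (subst (asm) integrable_completion) auto
qed

lemma set_integrable_Mellin_kernel:
  assumes b: "b > 0" and cont: "continuous_on {b..} f"
    and le: "\<And>t. t \<ge> b \<Longrightarrow> \<bar>f t\<bar> \<le> C * t powr c" and s: "Re s > c"
  shows "set_integrable lborel {b..} (Mellin_kernel f s)"
proof (rule set_integrable_bound)
  show "set_integrable lborel {b..} (\<lambda>t. C * t powr (c - Re s - 1))"
    using b s by (intro set_integrable_mult_right set_integrable_powr_tail) auto
  show "set_borel_measurable lborel {b..} (Mellin_kernel f s)"
    unfolding set_borel_measurable_def
    using b by (auto intro!: borel_measurable_continuous_on_indicator continuous_on_Mellin_kernel cont)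
  show "AE t in lborel. t \<in> {b..} \<longrightarrow>
      norm (Mellin_kernel f s t) \<le> norm (C * t powr (c - Re s - 1))"
  proof (intro AE_I2 impI)
    fix t assume t: "t \<in> {b..}"
    then have "norm (Mellin_kernel f s t) \<le> t powr (- Re s - 1) * (C * t powr c)"
      using b le by (subst norm_Mellin_kernel) (auto intro!: mult_left_mono)
    also have "\<dots> = C * t powr (c - Re s - 1)"
      using powr_add[of t "- Re s - 1" c] by (simp add: algebra_simps)
    finally show "norm (Mellin_kernel f s t) \<le> norm (C * t powr (c - Re s - 1))" by simp
  qed
qed

text \<open>On and to the left of the critical line the kernel dominates a multiple of \<open>1 / t\<close>, whose integrals
grow like a logarithm.\<close>

lemma not_set_integrable_Mellin_kernel:
  assumes \<kappa>: "\<kappa> > 0" and ge: "eventually (\<lambda>t. \<kappa> * t powr c \<le> f t) at_top" and s: "Re s \<le> c"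
  shows "\<not> set_integrable lborel {b..} (Mellin_kernel f s)"
proof
  assume int: "set_integrable lborel {b..} (Mellin_kernel f s)"
  obtain b0 where b0: "\<And>t. t \<ge> b0 \<Longrightarrow> \<kappa> * t powr c \<le> f t"
    using ge by (auto simp: eventually_at_top_linorder)
  define a where "a = max 1 (max b b0)"
  have a: "a \<ge> 1" "a \<ge> b" "a \<ge> b0" by (auto simp: a_def)
  have bound: "\<kappa> / t \<le> norm (Mellin_kernel f s t)" if "t \<ge> a" for t
  proof -
    have t: "t \<ge> 1" "t \<ge> b0" using that a by auto
    have "\<kappa> / t = \<kappa> * t powr (- 1)"
      using t by (simp add: powr_minus divide_inverse)
    also have "\<dots> \<le> \<kappa> * t powr (c - Re s - 1)"
      using t s \<kappa> by (intro mult_left_mono powr_mono) auto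
    also have "\<dots> = t powr (- Re s - 1) * (\<kappa> * t powr c)"
      using powr_add[of t "- Re s - 1" c] by (simp add: algebra_simps)
    also have "\<dots> \<le> t powr (- Re s - 1) * \<bar>f t\<bar>"
      using b0[OF t(2)] by (intro mult_left_mono) auto
    finally show ?thesis using t by (simp add: norm_Mellin_kernel)
  qed
  have "set_integrable lborel {a..} (\<lambda>t. norm (Mellin_kernel f s t))"
    using set_integrable_subset[OF int, of "{a..}"] a by (intro set_integrable_norm) auto
  then have int_norm: "(\<lambda>t. norm (Mellin_kernel f s t)) integrable_on {a..}"
    by (rule set_borel_integral_eq_integral)
  define I where "I = integral {a..} (\<lambda>t. norm (Mellin_kernel f s t))"
  have "\<kappa> * (ln x - ln a) \<le> I" if x: "x \<ge> a" for x
  proof -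
    have "((\<lambda>t. \<kappa> / t) has_integral (\<kappa> * ln x - \<kappa> * ln a)) {a..x}"
      using a x by (intro fundamental_theorem_of_calculus)
        (auto intro!: derivative_eq_intros simp flip: has_real_derivative_iff_has_vector_derivative)
    moreover have "(\<lambda>t. norm (Mellin_kernel f s t)) integrable_on {a..x}"
      using set_integrable_subset[OF int, of "{a..x}"] a
      by (intro set_borel_integral_eq_integral set_integrable_norm) auto
    ultimately have "\<kappa> * ln x - \<kappa> * ln a \<le> integral {a..x} (\<lambda>t. norm (Mellin_kernel f s t))"
      using bound by (metis (no_types, lifting) atLeastAtMost_iff has_integral_le integrable_integral)
    also have "\<dots> \<le> I"
      unfolding I_def
      by (intro integral_subset_le int_norm set_borel_integral_eq_integral set_integrable_norm
          set_integrable_subset[OF int]) (use a in auto)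
    finally show ?thesis by (simp add: algebra_simps)
  qed
  moreover have "eventually (\<lambda>x. \<kappa> * (ln x - ln a) > I) at_top"
    using \<kappa> by real_asymp
  then obtain x where "x \<ge> a" "\<kappa> * (ln x - ln a) > I"
    by (metis eventually_at_top_linorder linorder_le_cases)
  ultimately show False by (meson not_less)
qed

lemma tail_Mellin_split:
  assumes int: "set_integrable lborel {b..} (Mellin_kernel f s)" and x: "x \<ge> b"
  shows "tail_Mellin b f s = integral {b..x} (Mellin_kernel f s) + integral {x..} (Mellin_kernel f s)"
proof -
  have sub: "Mellin_kernel f s integrable_on A" if "A \<in> sets borel" "A \<subseteq> {b..}" for A
    using set_integrable_subset[OF int, of A] that
    by (intro set_borel_integral_eq_integral) auto
  have "{b..} = {b..x} \<union> {x..}" using x by auto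
  then have "tail_Mellin b f s = integral ({b..x} \<union> {x..}) (Mellin_kernel f s)"
    unfolding tail_Mellin_def using set_borel_integral_eq_integral(2)[OF int] by simp
  also have "\<dots> = integral {b..x} (Mellin_kernel f s) + integral {x..} (Mellin_kernel f s)"
  proof (intro Henstock_Kurzweil_Integration.integral_Un sub)
    have "{b..x} \<inter> {x..} = {x}" using x by auto
    then show "negligible ({b..x} \<inter> {x..})" by simp
  qed (use x in auto)
  finally show ?thesis .
qed

text \<open>Both the truncated Mellin transform (with \<open>g = - ln\<close>) and the integral over one period (with
\<open>g x = - x\<close>) have this form.\<close>

lemma holomorphic_on_compact_Laplace:
  fixes h :: "real \<Rightarrow> complex" and g :: "real \<Rightarrow> real"
  assumes "continuous_on {a..b} h" "continuous_on {a..b} g" and U: "convex U"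
  shows "(\<lambda>s. integral {a..b} (\<lambda>x. exp (s * of_real (g x)) * h x)) holomorphic_on U"
proof -
  have "(\<lambda>s. integral (cbox a b) (\<lambda>x. exp (s * of_real (g x)) * h x)) holomorphic_on U"
  proof (rule leibniz_rule_holomorphic[OF _ _ _ U])
    show "((\<lambda>s. exp (s * of_real (g t)) * h t) has_field_derivative
        of_real (g t) * exp (s * of_real (g t)) * h t) (at s within U)" for s t
      by (auto intro!: derivative_eq_intros)
    show "(\<lambda>x. exp (s * of_real (g x)) * h x) integrable_on cbox a b" for s
      using assms by (intro integrable_continuous continuous_intros) auto
    have "continuous_on (U \<times> {a..b}) (\<lambda>p. g (snd p))" "continuous_on (U \<times> {a..b}) (\<lambda>p. h (snd p))"
      by (rule continuous_on_compose2[OF assms(2)] continuous_on_compose2[OF assms(1)];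
          auto intro!: continuous_intros)+
    then show "continuous_on (U \<times> cbox a b)
        (\<lambda>(s, t). of_real (g t) * exp (s * of_real (g t)) * h t)"
      unfolding split_beta by (intro continuous_intros) auto
  qed
  then show ?thesis by simp
qed

lemma holomorphic_truncated_Mellin:
  assumes b: "b > 0" and cont: "continuous_on {b..} f" and U: "convex U"
  shows "(\<lambda>s. integral {b..x} (Mellin_kernel f s)) holomorphic_on U"
proof -
  have "(\<lambda>s. integral {b..x} (\<lambda>t. exp (s * of_real (- ln t)) * (exp (- of_real (ln t)) * of_real (f t))))
      holomorphic_on U"
    using b by (intro holomorphic_on_compact_Laplace continuous_intros U continuous_on_subset[OF cont]) auto
  moreover have "integral {b..x} (Mellin_kernel f s) =
      integral {b..x} (\<lambda>t. exp (s * of_real (- ln t)) * (exp (- of_real (ln t)) * of_real (f t)))" for s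
    using b by (intro integral_cong) (auto simp: Mellin_kernel_exp algebra_simps simp flip: exp_add)
  ultimately show ?thesis by simp
qed

text \<open>The transform is the locally uniform limit of the truncated transforms: on a closed disc inside the
half-plane \<open>Re s - c\<close> is bounded below by some \<open>d > 0\<close>, so the omitted tail from \<open>x \<ge> 1\<close> on is at most
\<open>C / d * x powr (- d)\<close>.\<close>

lemma holomorphic_tail_Mellin:
  assumes b: "b > 0" and cont: "continuous_on {b..} f"
    and le: "\<And>t. t \<ge> b \<Longrightarrow> \<bar>f t\<bar> \<le> C * t powr c"
  shows "tail_Mellin b f holomorphic_on {s. Re s > c}"
proof (rule holomorphic_uniform_sequence)
  show "open {s. Re s > c}" by (rule open_halfspace_Re_gt)
  show "(\<lambda>s. integral {b..b + real n} (Mellin_kernel f s)) holomorphic_on {s. Re s > c}" for n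
    by (intro holomorphic_truncated_Mellin b cont convex_halfspace_Re_gt)
  fix s0 assume s0: "s0 \<in> {s. Re s > c}"
  define d where "d = (Re s0 - c) / 2"
  define e where "e = - d - 1"
  have d: "d > 0" using s0 by (simp add: d_def)
  have "0 \<le> C * b powr c"
    using le[of b] by linarith
  then have C: "C \<ge> 0"
    using b by (simp add: zero_le_mult_iff)
  have Re_ge: "Re s \<ge> c + d" if "s \<in> cball s0 d" for s
  proof -
    have "\<bar>Re (s0 - s)\<bar> \<le> d"
      using that abs_Re_le_cmod[of "s0 - s"] by (auto simp: dist_norm)
    moreover have "Re s0 = c + 2 * d" by (simp add: d_def diff_divide_distrib)
    ultimately show ?thesis by (simp add: abs_le_iff)
  qed
  have tail: "norm (tail_Mellin b f s - integral {b..b + real n} (Mellin_kernel f s))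
      \<le> C / d * (b + real n) powr (- d)" if s: "s \<in> cball s0 d" and n: "n \<ge> 1" for s n
  proof -
    define x where "x = b + real n"
    have x: "x \<ge> 1" "x \<ge> b" using b n by (auto simp: x_def)
    have int: "set_integrable lborel {b..} (Mellin_kernel f s)"
      using Re_ge[OF s] d by (intro set_integrable_Mellin_kernel[OF b cont le]) auto
    have "norm (tail_Mellin b f s - integral {b..x} (Mellin_kernel f s))
        = norm (integral {x..} (Mellin_kernel f s))"
      using tail_Mellin_split[OF int x(2)] by simp
    also have "\<dots> \<le> C * (- (x powr (e + 1)) / (e + 1))"
    proof (rule integral_norm_bound_integral[THEN order_trans])
      show "Mellin_kernel f s integrable_on {x..}"
        using set_integrable_subset[OF int, of "{x..}"] x
        by (intro set_borel_integral_eq_integral) auto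
      have hi: "((\<lambda>t. C * t powr e) has_integral C * (- (x powr (e + 1)) / (e + 1))) {x..}"
        using d x by (intro has_integral_mult_right has_integral_powr_to_inf) (auto simp: e_def)
      then show "(\<lambda>t. C * t powr e) integrable_on {x..}"
        "integral {x..} (\<lambda>t. C * t powr e) \<le> C * (- (x powr (e + 1)) / (e + 1))"
        using integral_unique[OF hi] by (blast, simp only: order_refl)
      fix t assume t: "t \<in> {x..}"
      then have t1: "t \<ge> 1" "t \<ge> b" using x by auto
      have "norm (Mellin_kernel f s t) \<le> t powr (- Re s - 1) * (C * t powr c)"
        using t1 le by (subst norm_Mellin_kernel) (auto intro!: mult_left_mono)
      also have "\<dots> = C * t powr (c - Re s - 1)"
        using powr_add[of t "- Re s - 1" c] by (simp add: algebra_simps)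
      also have "\<dots> \<le> C * t powr e"
        using C t1 Re_ge[OF s] by (intro mult_left_mono powr_mono) (auto simp: e_def)
      finally show "norm (Mellin_kernel f s t) \<le> C * t powr e" .
    qed
    also have "\<dots> = C / d * x powr (- d)"
      using d by (simp add: e_def field_simps)
    finally show ?thesis by (simp add: x_def)
  qed
  have "uniform_limit (cball s0 d) (\<lambda>n s. integral {b..b + real n} (Mellin_kernel f s)) (tail_Mellin b f) sequentially"
  proof (rule uniform_limitI)
    fix \<epsilon> :: real assume \<epsilon>: "\<epsilon> > 0"
    have "((\<lambda>n. C / d * (b + real n) powr (- d)) \<longlongrightarrow> C / d * 0) sequentially"
      by (intro tendsto_mult tendsto_const tendsto_neg_powr
          filterlim_tendsto_add_at_top[OF tendsto_const] filterlim_real_sequentially) (use d in auto)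
    then have "eventually (\<lambda>n. C / d * (b + real n) powr (- d) < \<epsilon>) sequentially"
      using \<epsilon> by (intro order_tendstoD) auto
    then show "eventually (\<lambda>n. \<forall>s\<in>cball s0 d.
        dist (integral {b..b + real n} (Mellin_kernel f s)) (tail_Mellin b f s) < \<epsilon>) sequentially"
      using eventually_ge_at_top[of 1]
    proof eventually_elim
      case (elim n)
      show ?case
      proof
        fix s assume "s \<in> cball s0 d"
        from tail[OF this elim(2)] elim(1)
        show "dist (integral {b..b + real n} (Mellin_kernel f s)) (tail_Mellin b f s) < \<epsilon>"
          by (simp add: dist_norm norm_minus_commute)
      qed
    qed
  qed
  moreover have "cball s0 d \<subseteq> {s. Re s > c}"
    using Re_ge d by force
  ultimately show "\<exists>d>0. cball s0 d \<subseteq> {s. c < Re s} \<and>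
      uniform_limit (cball s0 d) (\<lambda>n s. integral {b..b + real n} (Mellin_kernel f s)) (tail_Mellin b f) sequentially"
    using d by blast
qed

text \<open>The substitution \<open>t = exp x\<close> turns the factor \<open>exp T\<close> between the endpoints into one additive period.\<close>

lemma log_periodic_truncated_Mellin:
  fixes G :: "real \<Rightarrow> real"
  assumes b: "b > 0" and T: "T > 0" and cont: "continuous_on UNIV G"
  shows "integral {b..exp T * b} (Mellin_kernel (\<lambda>t. t powr c * G (ln t)) s)
    = integral {ln b..ln b + T} (\<lambda>x. exp (- (s - of_real c) * of_real x) * of_real (G x))"
proof -
  define k where "k = Mellin_kernel (\<lambda>t. t powr c * G (ln t)) s"
  have kcont: "continuous_on {b..exp T * b} k"
    unfolding k_def using b
    by (intro continuous_on_Mellin_kernel continuous_intros continuous_on_compose2[OF cont]) auto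
  have exp_b: "exp (ln b) = b" "exp (ln b + T) = exp T * b"
    using b by (simp_all add: exp_add)
  have "((\<lambda>x. exp x *\<^sub>R k (exp x)) has_integral integral {exp (ln b)..exp (ln b + T)} k) {ln b..ln b + T}"
  proof (rule has_integral_substitution)
    show "exp ` {ln b..ln b + T} \<subseteq> {b..exp T * b}"
    proof
      fix y assume "y \<in> exp ` {ln b..ln b + T}"
      then obtain x where "y = exp x" "exp (ln b) \<le> exp x" "exp x \<le> exp (ln b + T)" by auto
      then show "y \<in> {b..exp T * b}" unfolding exp_b by simp
    qed
    show "(exp has_field_derivative exp x) (at x within {ln b..ln b + T})" for x
      by (auto intro!: derivative_eq_intros)
  qed (use T kcont in auto)
  moreover have "exp x *\<^sub>R k (exp x) = exp (- (s - of_real c) * of_real x) * of_real (G x)" for x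
  proof -
    have "exp x *\<^sub>R k (exp x) =
        exp (of_real x) * (exp (- (s + 1) * of_real x) * exp (of_real c * of_real x)) * of_real (G x)"
      by (simp add: k_def Mellin_kernel_exp scaleR_conv_of_real powr_def flip: exp_of_real)
    also have "exp (of_real x) * (exp (- (s + 1) * of_real x) * exp (of_real c * of_real x))
        = exp (- (s - of_real c) * of_real x)"
      unfolding exp_add[symmetric] by (simp add: algebra_simps)
    finally show ?thesis .
  qed
  ultimately show ?thesis
    unfolding k_def[symmetric] by (simp add: integral_unique exp_b)
qed

text \<open>The function \<open>f t = t powr c * G (ln t)\<close> satisfies \<open>f (exp T * t) = exp (c * T) * f t\<close>. Rescaling the
integral from \<open>exp T * b\<close> to infinity by \<open>exp T\<close> reproduces the whole transform up to the factor
\<open>exp (- T * (s - c))\<close>; what is left over is the integral over one multiplicative period.\<close>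

lemma log_periodic_tail_Mellin:
  fixes G :: "real \<Rightarrow> real"
  assumes b: "b > 0" and T: "T > 0" and cont: "continuous_on UNIV G"
    and per: "\<And>x. G (x + T) = G x"
    and int: "set_integrable lborel {b..} (Mellin_kernel (\<lambda>t. t powr c * G (ln t)) s)"
  shows "(1 - exp (- of_real T * (s - of_real c))) * tail_Mellin b (\<lambda>t. t powr c * G (ln t)) s
    = integral {ln b..ln b + T} (\<lambda>x. exp (- (s - of_real c) * of_real x) * of_real (G x))"
proof -
  define f where "f = (\<lambda>t. t powr c * G (ln t))"
  define k where "k = Mellin_kernel f s"
  define q where "q = exp T"
  have q: "q > 1" using T by (simp add: q_def)
  have int': "set_integrable lborel {b..} k" using int by (simp add: k_def f_def)
  have scale: "q *\<^sub>R k (q * t) = exp (- of_real T * (s - of_real c)) * k t" if t: "t > 0" for t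
  proof -
    have "ln (q * t) = ln t + T" using t q by (simp add: ln_mult q_def)
    then have "f (q * t) = exp (c * T) * f t"
      using t q by (simp add: f_def per powr_mult) (simp add: powr_def q_def)
    then have f: "complex_of_real (f (exp T * t)) = exp (of_real c * of_real T) * of_real (f t)"
      by (simp add: q_def flip: exp_of_real)
    have "q *\<^sub>R k (q * t) = exp (of_real T) * (exp (- (s + 1) * (of_real (ln t) + of_real T)) *
        (exp (of_real c * of_real T) * of_real (f t)))"
      using t q \<open>ln (q * t) = ln t + T\<close>
      by (simp add: k_def Mellin_kernel_exp f scaleR_conv_of_real q_def exp_of_real)
    also have "\<dots> = (exp (of_real T) * exp (- (s + 1) * of_real T) * exp (of_real c * of_real T)) * k t"
      using t by (simp add: k_def Mellin_kernel_exp ring_distribs exp_add)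
    also have "exp (of_real T) * exp (- (s + 1) * of_real T) * exp (of_real c * of_real T)
        = exp (- of_real T * (s - of_real c))"
      unfolding exp_add[symmetric] by (simp add: algebra_simps)
    finally show ?thesis .
  qed
  have qb: "q * b \<ge> b" using q b by simp
  have "tail_Mellin b f s = integral {b..q * b} k + integral {q * b..} k"
    using tail_Mellin_split[OF int'[unfolded k_def] qb] by (simp add: k_def)
  also have "integral {q * b..} k = (LINT t:{q * b..}|lborel. k t)"
    using set_integrable_subset[OF int', of "{q * b..}"] qb
    by (intro set_borel_integral_eq_integral(2)[symmetric]) auto
  also have "\<dots> = q *\<^sub>R (LINT t|lborel. indicator {q * b..} (0 + q * t) *\<^sub>R k (0 + q * t))"
    unfolding set_lebesgue_integral_def using q by (subst lborel_integral_real_affine[of q _ 0]) auto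
  also have "\<dots> = (LINT t:{b..}|lborel. exp (- of_real T * (s - of_real c)) * k t)"
    unfolding set_lebesgue_integral_def integral_scaleR_right[symmetric]
    by (intro Bochner_Integration.integral_cong)
       (use q b scale in \<open>auto simp: indicator_def\<close>)
  also have "\<dots> = exp (- of_real T * (s - of_real c)) * tail_Mellin b f s"
    by (simp add: tail_Mellin_def k_def)
  finally have "(1 - exp (- of_real T * (s - of_real c))) * tail_Mellin b f s = integral {b..q * b} k"
    unfolding left_diff_distrib mult_1_left diff_eq_eq .
  then show ?thesis
    using log_periodic_truncated_Mellin[OF b T cont, of c s]
    by (simp add: k_def f_def q_def)
qed

section \<open>Meromorphic quotients with poles on a vertical lattice\<close>

lemma exp_eq_1_iff_lattice_point:
  fixes D T :: real
  assumes T: "T > 0"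
  shows "exp (- of_real T * (s - of_real D)) = 1 \<longleftrightarrow> (\<exists>k. s = lattice_point D T k)"
proof
  assume "exp (- of_real T * (s - of_real D)) = 1"
  then obtain n :: int where n: "Re (- of_real T * (s - of_real D)) = 0"
      "Im (- of_real T * (s - of_real D)) = of_int (2 * n) * pi"
    unfolding exp_eq_1 by auto
  have "s = lattice_point D T (- n)"
    using n T by (simp add: complex_eq_iff lattice_point_def field_simps)
  then show "\<exists>k. s = lattice_point D T k" ..
next
  assume "\<exists>k. s = lattice_point D T k"
  then obtain k where s: "s = lattice_point D T k" ..
  have "- of_real T * (s - of_real D) = 0 + \<i> * (of_int (- k) * (of_real pi * 2))"
    using T by (simp add: s lattice_point_def)
  then show "exp (- of_real T * (s - of_real D)) = 1"
    by (simp only: exp_plus_2pin exp_zero)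
qed

text \<open>The denominator vanishes to first order at \<open>w\<close> with derivative \<open>T\<close>. Dividing it by \<open>s - w\<close> leaves a
holomorphic function with value \<open>T\<close> at \<open>w\<close>, which stays nonzero nearby.\<close>

lemma lattice_quotient_local_form:
  fixes D T :: real
  assumes U: "open U" and w: "w \<in> U" and \<Phi>: "\<Phi> holomorphic_on U" and M: "M holomorphic_on U"
    and T: "T > 0" and lat: "exp (- of_real T * (w - of_real D)) = 1"
  obtains S g where "open S" "w \<in> S" "g holomorphic_on S" "g w = \<Phi> w / of_real T"
    "\<And>s. s \<in> S \<Longrightarrow> s \<noteq> w \<Longrightarrow> M s + \<Phi> s / (1 - exp (- of_real T * (s - of_real D))) = g s / (s - w)"
proof -
  define h where "h = (\<lambda>s::complex. 1 - exp (- of_real T * (s - of_real D)))"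
  define e where "e = (\<lambda>s. if s = w then deriv h w else (h s - h w) / (s - w))"
  have "(h has_field_derivative of_real T * exp (- of_real T * (w - of_real D))) (at w)"
    unfolding h_def by (auto intro!: derivative_eq_intros)
  then have h': "deriv h w = of_real T" using lat by (simp add: DERIV_imp_deriv)
  have hw: "h w = 0" using lat by (simp add: h_def)
  have "e holomorphic_on U"
    unfolding e_def
    by (rule pole_lemma) (use U w in \<open>auto simp: h_def interior_open intro!: holomorphic_intros\<close>)
  then have "continuous_on U e" by (rule holomorphic_on_imp_continuous_on)
  then have "open (e -` (- {0}) \<inter> U)"
    using continuous_on_open_vimage[OF U] by blast
  define S where "S = e -` (- {0}) \<inter> U"
  define g where "g = (\<lambda>s. M s * (s - w) + \<Phi> s / e s)"
  show ?thesis
  proof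
    show "open S" unfolding S_def by fact
    show "w \<in> S" using w h' T by (simp add: S_def e_def)
    show "g holomorphic_on S"
      unfolding g_def S_def
      by (intro holomorphic_intros holomorphic_on_subset[OF M] holomorphic_on_subset[OF \<Phi>]
          holomorphic_on_subset[OF \<open>e holomorphic_on U\<close>]) auto
    show "g w = \<Phi> w / of_real T" by (simp add: g_def e_def h')
    fix s assume s: "s \<in> S" "s \<noteq> w"
    then have hs: "h s = e s * (s - w)" and "e s \<noteq> 0" by (auto simp: e_def hw S_def)
    then have "M s + \<Phi> s / h s = g s / (s - w)"
      unfolding hs g_def using s by (simp add: field_simps)
    then show "M s + \<Phi> s / (1 - exp (- of_real T * (s - of_real D))) = g s / (s - w)"
      by (simp add: h_def)
  qed
qed

text \<open>The residue formula covers the case \<open>g w = 0\<close> as well, in which the singularity is removable. So the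
residues at all lattice points can be treated uniformly, whether or not they are poles.\<close>

lemma simple_quotient_singularity:
  assumes S: "open S" "w \<in> S" and g: "g holomorphic_on S"
    and eq: "\<And>s. s \<in> S \<Longrightarrow> s \<noteq> w \<Longrightarrow> F s = g s / (s - w)"
  shows "residue F w = g w" "is_pole F w \<longleftrightarrow> g w \<noteq> 0" "g w \<noteq> 0 \<Longrightarrow> zorder F w = - 1"
    "isolated_singularity_at F w"
proof -
  have ev: "eventually (\<lambda>s. F s = g s / (s - w)) (at w)"
    using eventually_at_in_open'[OF S] eventually_neq_at_within[of w] 
    by eventually_elim (use eq in auto)
  show "residue F w = g w"
    using residue_cong[OF ev refl] residue_simple[OF S g] by simp
  have pole: "is_pole F w" if "g w \<noteq> 0"
    using is_pole_cong[OF ev refl] is_pole_basic[OF g S that, of 1] by simp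
  moreover have "\<not> is_pole F w" if "g w = 0"
  proof -
    have "(g has_field_derivative deriv g w) (at w)"
      using g S by (simp add: holomorphic_derivI)
    then have "((\<lambda>s. g s / (s - w)) \<longlongrightarrow> deriv g w) (at w)"
      using that by (simp add: has_field_derivative_iff)
    then have "(F \<longlongrightarrow> deriv g w) (at w)"
      using tendsto_cong[OF ev] by blast
    then show ?thesis
      unfolding is_pole_def using not_tendsto_and_filterlim_at_infinity[of "at w"] by auto
  qed
  ultimately show "is_pole F w \<longleftrightarrow> g w \<noteq> 0" by blast
  show "zorder F w = - 1" if "g w \<noteq> 0"
    by (rule zorder_eqI[OF S g that]) (simp add: eq power_int_minus divide_inverse)
  have "F holomorphic_on (S - {w})"
    by (subst holomorphic_cong[OF refl eq])
       (auto intro!: holomorphic_intros holomorphic_on_subset[OF g])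
  then show "isolated_singularity_at F w"
    using S by (intro isolated_singularity_at_holomorphic) auto
qed

text \<open>By the identity theorem the two extensions agree near every point except possibly at the point itself;
a nicely meromorphic function is determined at a point by its values nearby.\<close>

lemma nicely_meromorphic_extension_unique:
  assumes Z: "is_meromorphic_extension f A Z U" and Z': "is_meromorphic_extension f A Z' U"
    and A: "open A" "A \<noteq> {}" and U: "open U" "connected U" and w: "w \<in> U"
  shows "Z' w = Z w"
proof -
  have nice: "Z nicely_meromorphic_on U" "Z' nicely_meromorphic_on U" and "A \<subseteq> U"
    and eqA: "\<And>s. s \<in> A \<Longrightarrow> Z' s - Z s = 0"
    using Z Z' by (auto simp: is_meromorphic_extension_def)
  have "(\<lambda>s. Z' s - Z s) meromorphic_on U"
    using nice by (intro meromorphic_on_diff) (auto simp: nicely_meromorphic_on_def)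
  then have "eventually (\<lambda>s. Z' s - Z s = 0) (cosparse U) \<or> eventually (\<lambda>s. Z' s - Z s \<noteq> 0) (cosparse U)"
    by (rule meromorphic_imp_constant_or_avoid[OF _ U])
  moreover have False if "eventually (\<lambda>s. Z' s - Z s \<noteq> 0) (cosparse U)"
  proof -
    obtain a where a: "a \<in> A" using A by blast
    then have "eventually (\<lambda>s. Z' s - Z s \<noteq> 0) (at a)"
      using that \<open>A \<subseteq> U\<close> U by (auto simp: eventually_cosparse_open_eq)
    moreover have "eventually (\<lambda>s. Z' s - Z s = 0) (at a)"
      using eventually_at_in_open'[OF A(1) a] by eventually_elim (rule eqA)
    ultimately have "eventually (\<lambda>s. False) (at a)" by eventually_elim auto
    then show False by simp
  qed
  ultimately have ev: "eventually (\<lambda>s. Z' s = Z s) (at w)"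
    using w U by (auto simp: eventually_cosparse_open_eq)
  have "is_pole Z' w \<longleftrightarrow> is_pole Z w" and lim: "Z' \<midarrow>w\<rightarrow> c \<longleftrightarrow> Z \<midarrow>w\<rightarrow> c" for c
    using is_pole_cong[OF ev refl] tendsto_cong[OF ev] by auto
  moreover have "(is_pole Z w \<and> Z w = 0) \<or> Z \<midarrow>w\<rightarrow> Z w" "(is_pole Z' w \<and> Z' w = 0) \<or> Z' \<midarrow>w\<rightarrow> Z' w"
    using nice w by (auto simp: nicely_meromorphic_on_def)
  moreover have "\<not> (is_pole Z w \<and> Z \<midarrow>w\<rightarrow> c)" for c
    unfolding is_pole_def using not_tendsto_and_filterlim_at_infinity[of "at w"] by auto
  ultimately show ?thesis
    by (metis LIM_unique)
qed

text \<open>Removing the removable singularities handles those lattice points at which the numerator vanishes,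
where the quotient as written only has the default value of a division by zero.\<close>

lemma lattice_quotient_meromorphic:
  fixes D T :: real
  assumes U: "open U" and \<Phi>: "\<Phi> holomorphic_on U" and M: "M holomorphic_on U" and T: "T > 0"
  defines "F \<equiv> \<lambda>s. M s + \<Phi> s / (1 - exp (- of_real T * (s - of_real D)))"
  shows "remove_sings F nicely_meromorphic_on U"
    and "\<And>w. w \<in> U \<Longrightarrow> (\<nexists>k. w = lattice_point D T k) \<Longrightarrow> remove_sings F w = F w"
    and "poles_in (remove_sings F) U = {lattice_point D T k | k. lattice_point D T k \<in> U \<and> \<Phi> (lattice_point D T k) \<noteq> 0}"
    and "\<And>w. w \<in> poles_in (remove_sings F) U \<Longrightarrow> zorder (remove_sings F) w = - 1"
    and "\<And>k. lattice_point D T k \<in> U \<Longrightarrow>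
      residue (remove_sings F) (lattice_point D T k) = \<Phi> (lattice_point D T k) / of_real T"
proof -
  have mero: "F meromorphic_on U"
    unfolding F_def using analytic_on_open[OF U] \<Phi> M
    by (intro meromorphic_on_add meromorphic_on_divide analytic_on_imp_meromorphic_on[of M]
        analytic_on_imp_meromorphic_on[of \<Phi>]
        analytic_on_imp_meromorphic_on[of "\<lambda>s. 1 - exp (- of_real T * (s - of_real D))"] analytic_intros) auto
  then show "remove_sings F nicely_meromorphic_on U"
    by (rule remove_sings_nicely_meromorphic)
  have iso: "isolated_singularity_at F w" if "w \<in> U" for w
    using meromorphic_on_isolated_singularity meromorphic_on_subset[OF mero, of "{w}"] that by auto
  have ana: "F analytic_on {w}" if "w \<in> U" "\<nexists>k. w = lattice_point D T k" for w
  proof -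
    have "M analytic_on {w}" "\<Phi> analytic_on {w}"
      using that(1) U M \<Phi> analytic_at by blast+
    then show ?thesis
      unfolding F_def using that(2) exp_eq_1_iff_lattice_point[OF T, of w D]
      by (intro analytic_intros) auto
  qed
  then show "\<And>w. w \<in> U \<Longrightarrow> (\<nexists>k. w = lattice_point D T k) \<Longrightarrow> remove_sings F w = F w"
    by simp
  have latt: "residue F (lattice_point D T k) = \<Phi> (lattice_point D T k) / of_real T \<and>
      (is_pole F (lattice_point D T k) \<longleftrightarrow> \<Phi> (lattice_point D T k) \<noteq> 0) \<and>
      (\<Phi> (lattice_point D T k) \<noteq> 0 \<longrightarrow> zorder F (lattice_point D T k) = - 1)"
    if k: "lattice_point D T k \<in> U" for k
  proof -
    have "exp (- of_real T * (lattice_point D T k - of_real D)) = 1"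
      using exp_eq_1_iff_lattice_point[OF T] by blast
    then obtain S g where Sg: "open S" "lattice_point D T k \<in> S" "g holomorphic_on S"
      "g (lattice_point D T k) = \<Phi> (lattice_point D T k) / of_real T"
      "\<And>s. s \<in> S \<Longrightarrow> s \<noteq> lattice_point D T k \<Longrightarrow> F s = g s / (s - lattice_point D T k)"
      unfolding F_def using lattice_quotient_local_form[OF U k \<Phi> M T] by metis
    show ?thesis
      using simple_quotient_singularity[OF Sg(1-3,5)] Sg(4) T by auto
  qed
  show poles: "poles_in (remove_sings F) U =
      {lattice_point D T k | k. lattice_point D T k \<in> U \<and> \<Phi> (lattice_point D T k) \<noteq> 0}"
  proof (intro set_eqI iffI)
    fix w assume "w \<in> poles_in (remove_sings F) U"
    then have w: "w \<in> U" "is_pole F w" using iso by (auto simp: poles_in_def)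
    then obtain k where "w = lattice_point D T k"
      using analytic_at_imp_no_pole[OF ana] by blast
    then show "w \<in> {lattice_point D T k | k. lattice_point D T k \<in> U \<and> \<Phi> (lattice_point D T k) \<noteq> 0}"
      using w latt by blast
  qed (use latt iso in \<open>auto simp: poles_in_def\<close>)
  show "zorder (remove_sings F) w = - 1" if "w \<in> poles_in (remove_sings F) U" for w
    using that latt iso unfolding poles by auto
  show "residue (remove_sings F) (lattice_point D T k) = \<Phi> (lattice_point D T k) / of_real T"
    if "lattice_point D T k \<in> U" for k
    using latt iso that by simp
qed

section \<open>Volumes of tails and logarithmically periodic limits\<close>

lemma tail_at_lmeasurable:
  assumes "\<Omega> \<in> lmeasurable"
  shows "tail_at t \<Omega> \<in> lmeasurable"
proof -
  have "tail_at t \<Omega> = \<Omega> - ball 0 t" by (auto simp: tail_at_def)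
  then show ?thesis using assms by (simp add: fmeasurable_Diff)
qed

text \<open>Two tails differ by a subset of a spherical shell, whose volume is a continuous function of the radii.\<close>

lemma tail_measure_diff_le:
  fixes \<Omega> :: "'a::euclidean_space set"
  assumes \<Omega>: "\<Omega> \<in> lmeasurable" and st: "0 \<le> s" "s \<le> t"
  shows "\<bar>measure lebesgue (tail_at s \<Omega>) - measure lebesgue (tail_at t \<Omega>)\<bar>
    \<le> (t ^ DIM('a) - s ^ DIM('a)) * measure lborel (ball (0::'a) 1)"
proof -
  have sub: "tail_at t \<Omega> \<subseteq> tail_at s \<Omega>"
    using st by (auto simp: tail_at_def)
  have "measure lebesgue (tail_at s \<Omega>) - measure lebesgue (tail_at t \<Omega>)
      = measure lebesgue (tail_at s \<Omega> - tail_at t \<Omega>)"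
    using tail_at_lmeasurable[OF \<Omega>] sub by (intro measurable_measure_Diff[symmetric]) auto
  moreover have "\<dots> \<le> measure lebesgue (ball (0::'a) t - ball 0 s)"
    using tail_at_lmeasurable[OF \<Omega>]
    by (intro measure_mono_fmeasurable) (auto simp: tail_at_def fmeasurable_Diff)
  moreover have "\<dots> = measure lborel (ball (0::'a) t) - measure lborel (ball (0::'a) s)"
    using st by (subst measurable_measure_Diff) (auto intro!: subset_ball)
  moreover have "measure lebesgue (tail_at t \<Omega>) \<le> measure lebesgue (tail_at s \<Omega>)"
    using tail_at_lmeasurable[OF \<Omega>] sub by (intro measure_mono_fmeasurable) auto
  ultimately have "\<bar>measure lebesgue (tail_at s \<Omega>) - measure lebesgue (tail_at t \<Omega>)\<bar>
      \<le> measure lborel (ball (0::'a) t) - measure lborel (ball (0::'a) s)"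
    by linarith
  then show ?thesis
    using st content_ball_conv_unit_ball[of t "0::'a"] content_ball_conv_unit_ball[of s "0::'a"]
    by (simp add: left_diff_distrib)
qed

lemma continuous_on_tail_measure:
  fixes \<Omega> :: "'a::euclidean_space set"
  assumes \<Omega>: "\<Omega> \<in> lmeasurable"
  shows "continuous_on {0..} (\<lambda>t. measure lebesgue (tail_at t \<Omega>))"
  unfolding continuous_on_def
proof
  fix t :: real assume t: "t \<in> {0..}"
  let ?V = "\<lambda>t. measure lebesgue (tail_at t \<Omega>)"
  have le: "norm (?V s - ?V t) \<le> \<bar>s ^ DIM('a) - t ^ DIM('a)\<bar> * measure lborel (ball (0::'a) 1)" if "s \<in> {0..}" for s
  proof (cases "s \<le> t")
    case True
    then show ?thesis
      using tail_measure_diff_le[OF \<Omega>, of s t] that power_mono[of s t "DIM('a)"] by simp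
  next
    case False
    then show ?thesis
      using tail_measure_diff_le[OF \<Omega>, of t s] t power_mono[of t s "DIM('a)"] by (simp add: abs_minus_commute)
  qed
  have "((\<lambda>s. \<bar>s ^ DIM('a) - t ^ DIM('a)\<bar> * measure lborel (ball (0::'a) 1)) \<longlongrightarrow>
      \<bar>t ^ DIM('a) - t ^ DIM('a)\<bar> * measure lborel (ball (0::'a) 1)) (at t within {0..})"
    by (intro tendsto_intros)
  then have "((\<lambda>s. \<bar>s ^ DIM('a) - t ^ DIM('a)\<bar> * measure lborel (ball (0::'a) 1)) \<longlongrightarrow> 0) (at t within {0..})"
    by simp
  then have "((\<lambda>s. ?V s - ?V t) \<longlongrightarrow> 0) (at t within {0..})"
    by (rule Lim_null_comparison[rotated])
       (unfold eventually_at_filter, use le in \<open>auto intro!: always_eventually\<close>)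
  then show "(?V \<longlongrightarrow> ?V t) (at t within {0..})"
    by (rule LIM_zero_cancel)
qed

lemma filterlim_exp_arith:
  fixes T x :: real
  assumes "T > 0"
  shows "filterlim (\<lambda>n. exp (x + real n * T)) at_top sequentially"
proof (rule filterlim_compose[OF exp_at_top])
  have "filterlim (\<lambda>n. real n * T) at_top sequentially"
    by (rule filterlim_at_top_mult_tendsto_pos[OF tendsto_const assms filterlim_real_sequentially])
  then show "filterlim (\<lambda>n. x + real n * T) at_top sequentially"
    by (rule filterlim_tendsto_add_at_top[OF tendsto_const])
qed

text \<open>On a right half-line the functions \<open>Q (exp (x + n * T))\<close> converge to \<open>G\<close> uniformly, since the
convergence of \<open>Q t - G (ln t)\<close> as \<open>t\<close> tends to infinity does not depend on the phase of \<open>ln t\<close>.\<close>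

lemma log_periodic_limit_continuous:
  fixes G Q :: "real \<Rightarrow> real"
  assumes per: "\<And>x. G (x + T) = G x" and T: "T > 0" and cont: "continuous_on {0<..} Q"
    and lim: "((\<lambda>t. Q t - G (ln t)) \<longlongrightarrow> 0) at_top"
  shows "continuous_on UNIV G"
proof -
  have right_ray: "continuous_on {u<..} G" for u
  proof (rule uniform_limit_theorem)
    have "continuous_on {u<..} (\<lambda>x. Q (exp (x + real n * T)))" for n
      by (rule continuous_on_compose2[OF cont, of _ "\<lambda>x. exp (x + real n * T)"])
         (auto intro!: continuous_intros)
    then show "\<forall>\<^sub>F n in sequentially. continuous_on {u<..} (\<lambda>x. Q (exp (x + real n * T)))"
      by simp
    show "uniform_limit {u<..} (\<lambda>n x. Q (exp (x + real n * T))) G sequentially"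
    proof (rule uniform_limitI)
      fix e :: real assume "e > 0"
      then have "eventually (\<lambda>t. dist (Q t - G (ln t)) 0 < e) at_top"
        using lim by (simp add: tendsto_iff)
      then obtain t0 where t0: "\<And>t. t \<ge> t0 \<Longrightarrow> \<bar>Q t - G (ln t)\<bar> < e"
        by (auto simp: eventually_at_top_linorder)
      have "filterlim (\<lambda>n. exp (u + real n * T)) at_top sequentially"
        by (intro filterlim_exp_arith T)
      then have "eventually (\<lambda>n. exp (u + real n * T) \<ge> t0) sequentially"
        by (simp add: filterlim_at_top)
      then show "\<forall>\<^sub>F n in sequentially. \<forall>x\<in>{u<..}. dist (Q (exp (x + real n * T))) (G x) < e"
      proof eventually_elim
        case (elim n)
        show ?case
        proof
          fix x assume "x \<in> {u<..}"
          then have "exp (u + real n * T) \<le> exp (x + real n * T)" by simp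
          from t0[OF order_trans[OF elim this]]
          have "\<bar>Q (exp (x + real n * T)) - G (x + real n * T)\<bar> < e"
            by (simp only: ln_exp)
          moreover have "G (x + real n * T) = G x"
            using periodic_add_int[of G T x "int n", OF per] by simp
          ultimately show "dist (Q (exp (x + real n * T))) (G x) < e"
            by (simp add: dist_real_def)
        qed
      qed
    qed
  qed simp
  have "isCont G x" for x
    using right_ray[of "x - 1"] continuous_on_eq_continuous_at[OF open_greaterThan[of "x - 1"], of G] by simp
  then show ?thesis by (simp add: continuous_at_imp_continuous_on)
qed

lemma log_periodic_limit_along_period:
  fixes G Q :: "real \<Rightarrow> real"
  assumes per: "\<And>x. G (x + T) = G x" and T: "T > 0"
    and lim: "((\<lambda>t. Q t - G (ln t)) \<longlongrightarrow> 0) at_top"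
  shows "((\<lambda>n. Q (exp (x + real n * T))) \<longlongrightarrow> G x) sequentially"
    and "filterlim (\<lambda>n. exp (x + real n * T)) at_top sequentially"
proof -
  show fl: "filterlim (\<lambda>n. exp (x + real n * T)) at_top sequentially"
    by (intro filterlim_exp_arith T)
  have "((\<lambda>n. Q (exp (x + real n * T)) - G (ln (exp (x + real n * T)))) \<longlongrightarrow> 0) sequentially"
    by (rule filterlim_compose[OF lim fl])
  moreover have "G (x + real n * T) = G x" for n
    using periodic_add_int[of G T x "int n", OF per] by simp
  ultimately have "((\<lambda>n. Q (exp (x + real n * T)) - G x) \<longlongrightarrow> 0) sequentially"
    by simp
  then show "((\<lambda>n. Q (exp (x + real n * T))) \<longlongrightarrow> G x) sequentially"
    by (rule LIM_zero_cancel)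
qed

text \<open>The maximum bounds the limit superior from above because \<open>Q\<close> is asymptotically at most \<open>M\<close>; it is
attained along the geometric progression through a point where \<open>G\<close> is maximal.\<close>

lemma Limsup_log_periodic:
  fixes G Q :: "real \<Rightarrow> real"
  assumes per: "\<And>x. G (x + T) = G x" and T: "T > 0"
    and lim: "((\<lambda>t. Q t - G (ln t)) \<longlongrightarrow> 0) at_top"
    and M: "has_maximum G M" "M \<ge> 0"
  shows "Limsup at_top (\<lambda>t. ennreal (Q t)) = ennreal M"
proof (rule antisym)
  show "Limsup at_top (\<lambda>t. ennreal (Q t)) \<le> ennreal M"
    unfolding Limsup_le_iff
  proof (intro allI impI)
    fix y assume y: "y > ennreal M"
    show "\<forall>\<^sub>F t in at_top. ennreal (Q t) < y"
    proof (cases y)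
      case (real r)
      then have r: "r > M" "r > 0" using y M by (auto simp: ennreal_less_iff)
      have "\<forall>\<^sub>F t in at_top. Q t - G (ln t) < r - M"
        using lim r by (intro order_tendstoD) auto
      then show ?thesis
      proof eventually_elim
        case (elim t)
        have "G (ln t) \<le> M" using M by (simp add: has_maximum_def)
        with elim have "Q t < r" by linarith
        then show ?case using real r by (simp add: ennreal_lessI)
      qed
    qed simp
  qed
  obtain x where x: "G x = M" using M by (auto simp: has_maximum_def)
  show "ennreal M \<le> Limsup at_top (\<lambda>t. ennreal (Q t))"
  proof (rule ccontr)
    assume "\<not> ennreal M \<le> Limsup at_top (\<lambda>t. ennreal (Q t))"
    then obtain y where y: "Limsup at_top (\<lambda>t. ennreal (Q t)) < y" "y < ennreal M"
      by (meson dense not_le)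
    have "((\<lambda>n. ennreal (Q (exp (x + real n * T)))) \<longlongrightarrow> ennreal M) sequentially"
      using log_periodic_limit_along_period(1)[OF per T lim, of x] x by (intro tendsto_ennrealI) simp
    then have "\<forall>\<^sub>F n in sequentially. y < ennreal (Q (exp (x + real n * T)))"
      using y by (intro order_tendstoD)
    moreover have "\<forall>\<^sub>F n in sequentially. ennreal (Q (exp (x + real n * T))) < y"
      using filterlim_iff[THEN iffD1, OF log_periodic_limit_along_period(2)[OF per T lim, of x]]
        Limsup_lessD[OF y(1)] by blast
    ultimately have "\<forall>\<^sub>F n in sequentially. False" by eventually_elim simp
    then show False by simp
  qed
qed

lemma Liminf_log_periodic:
  fixes G Q :: "real \<Rightarrow> real"
  assumes per: "\<And>x. G (x + T) = G x" and T: "T > 0"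
    and lim: "((\<lambda>t. Q t - G (ln t)) \<longlongrightarrow> 0) at_top"
    and m: "has_minimum G m" "m \<ge> 0"
  shows "Liminf at_top (\<lambda>t. ennreal (Q t)) = ennreal m"
proof (rule antisym)
  show "ennreal m \<le> Liminf at_top (\<lambda>t. ennreal (Q t))"
    unfolding le_Liminf_iff
  proof (intro allI impI)
    fix y assume y: "y < ennreal m"
    then obtain r where r: "y = ennreal r" "0 \<le> r" "r < m"
      by (cases y) (auto simp: ennreal_less_iff)
    have "\<forall>\<^sub>F t in at_top. Q t - G (ln t) > r - m"
      using lim r by (intro order_tendstoD) auto
    then show "\<forall>\<^sub>F t in at_top. y < ennreal (Q t)"
    proof eventually_elim
      case (elim t)
      have "G (ln t) \<ge> m" using m by (simp add: has_minimum_def)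
      with elim have "r < Q t" by linarith
      then show ?case using r by (simp add: ennreal_lessI)
    qed
  qed
  obtain x where x: "G x = m" using m by (auto simp: has_minimum_def)
  show "Liminf at_top (\<lambda>t. ennreal (Q t)) \<le> ennreal m"
  proof (rule ccontr)
    assume "\<not> Liminf at_top (\<lambda>t. ennreal (Q t)) \<le> ennreal m"
    then obtain y where y: "ennreal m < y" "y < Liminf at_top (\<lambda>t. ennreal (Q t))"
      by (meson dense not_le)
    have "((\<lambda>n. ennreal (Q (exp (x + real n * T)))) \<longlongrightarrow> ennreal m) sequentially"
      using log_periodic_limit_along_period(1)[OF per T lim, of x] x by (intro tendsto_ennrealI) simp
    then have "\<forall>\<^sub>F n in sequentially. ennreal (Q (exp (x + real n * T))) < y"
      using y by (intro order_tendstoD)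
    moreover have "\<forall>\<^sub>F n in sequentially. y < ennreal (Q (exp (x + real n * T)))"
      using filterlim_iff[THEN iffD1, OF log_periodic_limit_along_period(2)[OF per T lim, of x]]
        less_LiminfD[OF y(2)] by blast
    ultimately have "\<forall>\<^sub>F n in sequentially. False" by eventually_elim simp
    then show False by simp
  qed
qed

text \<open>Finite measure allows passing from quotients in \<open>ennreal\<close> to quotients of reals. This holds for \<open>t > 0\<close>
only, which suffices in the limit.\<close>

lemma Minkowski_content_real:
  fixes \<Omega> :: "'a::euclidean_space set"
  assumes \<Omega>: "\<Omega> \<in> lmeasurable"
  shows "upper_Minkowski_content r \<Omega> =
      Limsup at_top (\<lambda>t. ennreal (measure lebesgue (tail_at t \<Omega>) / t powr (real DIM('a) + r)))"
    and "lower_Minkowski_content r \<Omega> =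
      Liminf at_top (\<lambda>t. ennreal (measure lebesgue (tail_at t \<Omega>) / t powr (real DIM('a) + r)))"
proof -
  have "\<forall>\<^sub>F t in at_top. emeasure lebesgue (tail_at t \<Omega>) / ennreal (t powr (real DIM('a) + r))
      = ennreal (measure lebesgue (tail_at t \<Omega>) / t powr (real DIM('a) + r))"
    using eventually_gt_at_top[of 0]
  proof eventually_elim
    case (elim t)
    then show ?case
      using tail_at_lmeasurable[OF \<Omega>, of t]
      by (simp add: emeasure_eq_measure2 divide_ennreal)
  qed
  then show "upper_Minkowski_content r \<Omega> =
      Limsup at_top (\<lambda>t. ennreal (measure lebesgue (tail_at t \<Omega>) / t powr (real DIM('a) + r)))"
    "lower_Minkowski_content r \<Omega> =
      Liminf at_top (\<lambda>t. ennreal (measure lebesgue (tail_at t \<Omega>) / t powr (real DIM('a) + r)))"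
    unfolding upper_Minkowski_content_def lower_Minkowski_content_def
    by (auto intro!: Limsup_eq Liminf_eq)
qed

lemma Inf_ereal_greaterThan: "Inf (ereal ` {D<..}) = ereal D"
proof (rule Inf_eqI)
  fix y assume y: "\<And>i. i \<in> ereal ` {D<..} \<Longrightarrow> y \<le> i"
  show "y \<le> ereal D"
  proof (rule ccontr)
    assume "\<not> y \<le> ereal D"
    then obtain z where "ereal D < ereal z" "ereal z < y"
      using ereal_dense2 by (metis not_le)
    then show False using y[of "ereal z"] by auto
  qed
next
  show "\<And>i. i \<in> ereal ` {D<..} \<Longrightarrow> ereal D \<le> i" by (auto intro: less_imp_le)
qed

lemma Inf_ereal_atLeast: "Inf (ereal ` {D..}) = ereal D"
proof (rule antisym)
  show "Inf (ereal ` {D..}) \<le> ereal D" by (rule Inf_lower) simp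
  show "ereal D \<le> Inf (ereal ` {D..})" by (rule Inf_greatest) auto
qed

text \<open>An asymptotic bound extends down to any \<open>P > 0\<close> by compactness, at the price of a larger constant. Thus
the lower limit of the Mellin integrals may be the given \<open>P\<close>.\<close>

lemma eventually_powr_bound_extend:
  fixes f :: "real \<Rightarrow> real"
  assumes P: "P > 0" and cont: "continuous_on {P..} f"
    and ev: "\<forall>\<^sub>F t in at_top. \<bar>f t\<bar> \<le> C * t powr c"
  obtains C' where "\<And>t. t \<ge> P \<Longrightarrow> \<bar>f t\<bar> \<le> C' * t powr c"
proof -
  obtain t0 where t0: "\<And>t. t \<ge> t0 \<Longrightarrow> \<bar>f t\<bar> \<le> C * t powr c"
    using ev by (auto simp: eventually_at_top_linorder)
  have "compact ((\<lambda>t. f t / t powr c) ` {P..max P t0})"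
    using P by (intro compact_continuous_image continuous_intros continuous_on_subset[OF cont]) auto
  then obtain B where "\<forall>y \<in> (\<lambda>t. f t / t powr c) ` {P..max P t0}. norm y \<le> B"
    using compact_imp_bounded bounded_iff by metis
  then have B: "\<And>t. t \<in> {P..max P t0} \<Longrightarrow> \<bar>f t / t powr c\<bar> \<le> B"
    by simp
  have "\<bar>f t\<bar> \<le> max B C * t powr c" if t: "t \<ge> P" for t
  proof (cases "t \<ge> t0")
    case True
    then have "\<bar>f t\<bar> \<le> C * t powr c" by (rule t0)
    also have "\<dots> \<le> max B C * t powr c" by (intro mult_right_mono) auto
    finally show ?thesis .
  next
    case False
    then have "\<bar>f t / t powr c\<bar> \<le> B" using t by (intro B) auto
    then have "\<bar>f t\<bar> \<le> B * t powr c" using t P by (simp add: field_simps)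
    also have "\<dots> \<le> max B C * t powr c" by (intro mult_right_mono) auto
    finally show ?thesis .
  qed
  then show ?thesis by (rule that)
qed

section \<open>Sets whose tails have logarithmically periodic volume\<close>

locale log_periodic_tail =
  fixes \<Omega> :: "'a::euclidean_space set" and D \<alpha> T :: real and G :: "real \<Rightarrow> real"
  assumes lmeas: "\<Omega> \<in> lmeasurable"
    and \<alpha>: "\<alpha> > 0"
    and G_pos: "\<And>x. G x > 0"
    and nonconst: "\<not> G constant_on UNIV"
    and T: "T > 0"
    and per: "\<And>x. G (x + T) = G x"
    and asymp: "\<exists>E. E \<in> O[at_top](\<lambda>t. t powr (- \<alpha>)) \<and>
          (\<forall>\<^sub>F t in at_top. measure lebesgue (tail_at t \<Omega>)
                             = t powr (real DIM('a) + D) * (G (ln t) + E t))"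
begin

definition tail_volume :: "real \<Rightarrow> real" where
  "tail_volume t = measure lebesgue (tail_at t \<Omega>)"

text \<open>The growth exponent of the tail volume. With the present normalisation of the Mellin kernel, the
abscissa \<open>D\<close> of the tube zeta function corresponds to \<open>tail_exponent\<close> after translation by \<open>DIM('a)\<close>.\<close>

definition tail_exponent :: real where
  "tail_exponent = real DIM('a) + D"

definition leading :: "real \<Rightarrow> real" where
  "leading t = t powr tail_exponent * G (ln t)"

definition remainder :: "real \<Rightarrow> real" where
  "remainder t = tail_volume t - leading t"

lemma remainder_bound:
  obtains C where "\<forall>\<^sub>F t in at_top. \<bar>remainder t\<bar> \<le> C * t powr (tail_exponent - \<alpha>)"
proof -
  obtain E where E: "E \<in> O[at_top](\<lambda>t. t powr (- \<alpha>))"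
    and tube: "\<forall>\<^sub>F t in at_top. tail_volume t = t powr tail_exponent * (G (ln t) + E t)"
    using asymp by (auto simp: tail_volume_def tail_exponent_def)
  obtain C where C: "\<forall>\<^sub>F t in at_top. norm (E t) \<le> C * norm (t powr (- \<alpha>))"
    using E by (elim landau_o.bigE)
  from tube C have "\<forall>\<^sub>F t in at_top. \<bar>remainder t\<bar> \<le> C * t powr (tail_exponent - \<alpha>)"
  proof eventually_elim
    case (elim t)
    have "\<bar>remainder t\<bar> = t powr tail_exponent * \<bar>E t\<bar>"
      using elim(1) by (simp add: remainder_def leading_def distrib_left abs_mult)
    also have "\<dots> \<le> t powr tail_exponent * (C * t powr (- \<alpha>))"
      using elim(2) by (intro mult_left_mono) auto
    also have "\<dots> = C * t powr (tail_exponent - \<alpha>)"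
      using powr_add[of t tail_exponent "- \<alpha>"] by simp
    finally show ?case .
  qed
  then show ?thesis by (rule that)
qed

lemma normalised_tail_limit: "((\<lambda>t. tail_volume t / t powr tail_exponent - G (ln t)) \<longlongrightarrow> 0) at_top"
proof -
  obtain C where C: "\<forall>\<^sub>F t in at_top. \<bar>remainder t\<bar> \<le> C * t powr (tail_exponent - \<alpha>)"
    by (rule remainder_bound)
  have "((\<lambda>t. C * t powr (- \<alpha>)) \<longlongrightarrow> C * 0) at_top"
    by (intro tendsto_mult tendsto_const tendsto_neg_powr filterlim_ident) (use \<alpha> in auto)
  then have lim0: "((\<lambda>t. C * t powr (- \<alpha>)) \<longlongrightarrow> 0) at_top" by simp
  have "\<forall>\<^sub>F t in at_top. norm (tail_volume t / t powr tail_exponent - G (ln t)) \<le> C * t powr (- \<alpha>)"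
    using C eventually_gt_at_top[of 0]
  proof eventually_elim
    case (elim t)
    have "tail_volume t / t powr tail_exponent - G (ln t) = remainder t / t powr tail_exponent"
      using elim(2) by (simp add: remainder_def leading_def diff_divide_distrib)
    then have "norm (tail_volume t / t powr tail_exponent - G (ln t)) \<le> C * t powr (tail_exponent - \<alpha>) / t powr tail_exponent"
      using elim by (simp add: divide_right_mono)
    also have "\<dots> = C * t powr (- \<alpha>)"
      using elim(2) by (simp add: powr_diff powr_minus field_simps)
    finally show ?case .
  qed
  then show ?thesis by (rule Lim_null_comparison[OF _ lim0])
qed

lemma continuous_tail_volume: "A \<subseteq> {0..} \<Longrightarrow> continuous_on A tail_volume"
  using continuous_on_subset[OF continuous_on_tail_measure[OF lmeas]] by (simp add: tail_volume_def[abs_def])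

lemma continuous_G: "continuous_on UNIV G"
proof (rule log_periodic_limit_continuous[OF per T _ normalised_tail_limit])
  show "continuous_on {0<..} (\<lambda>t. tail_volume t / t powr tail_exponent)"
    by (intro continuous_intros continuous_tail_volume) auto
qed

lemma continuous_leading:
  assumes "A \<subseteq> {0<..}"
  shows "continuous_on A leading"
proof -
  have "continuous_on A (\<lambda>t. G (ln t))"
    by (rule continuous_on_compose2[OF continuous_G]) (use assms in \<open>auto intro!: continuous_intros\<close>)
  then show ?thesis
    unfolding leading_def[abs_def] using assms by (intro continuous_intros) auto
qed

lemma continuous_remainder:
  assumes "A \<subseteq> {0<..}"
  shows "continuous_on A remainder"
proof -
  have "A \<subseteq> {0..}" using assms by force
  then show ?thesis
    unfolding remainder_def[abs_def]
    by (intro continuous_on_diff continuous_tail_volume continuous_leading assms)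
qed

lemma G_extrema:
  obtains m M where "has_minimum G m" "has_maximum G M" "G ` {0..T} = {m..M}" "0 < m" "m < M"
proof -
  obtain m M where mM: "has_minimum G m" "has_maximum G M" "G ` {0..T} = {m..M}"
    by (rule periodic_range_interval[of G T, OF per T continuous_G])
  have "0 < m" using mM(1) G_pos by (auto simp: has_minimum_def)
  moreover have "m < M"
  proof (rule ccontr)
    assume "\<not> m < M"
    then have "G x = m" for x
      using mM(1,2) unfolding has_minimum_def has_maximum_def by (meson antisym order_trans leI)
    then show False using nonconst by (auto simp: constant_on_def)
  qed
  ultimately show ?thesis using mM that by blast
qed

lemma content_eq:
  "upper_Minkowski_content r \<Omega> = Limsup at_top (\<lambda>t. ennreal (tail_volume t / t powr (real DIM('a) + r)))"
  "lower_Minkowski_content r \<Omega> = Liminf at_top (\<lambda>t. ennreal (tail_volume t / t powr (real DIM('a) + r)))"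
  unfolding tail_volume_def by (rule Minkowski_content_real[OF lmeas])+

lemma upper_content_D: "has_maximum G M \<Longrightarrow> upper_Minkowski_content D \<Omega> = ennreal M"
  unfolding content_eq tail_exponent_def[symmetric]
  using G_pos by (intro Limsup_log_periodic[OF per T normalised_tail_limit])
    (auto simp: has_maximum_def intro: less_imp_le)

lemma lower_content_D: "has_minimum G m \<Longrightarrow> lower_Minkowski_content D \<Omega> = ennreal m"
  unfolding content_eq tail_exponent_def[symmetric]
  using G_pos by (intro Liminf_log_periodic[OF per T normalised_tail_limit])
    (auto simp: has_minimum_def intro: less_imp_le)

lemma tail_volume_upper_bound: obtains K where "K > 0" "\<forall>\<^sub>F t in at_top. \<bar>tail_volume t\<bar> \<le> K * t powr tail_exponent"
proof -
  obtain m M where M: "has_maximum G M" "0 < m" "m < M"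
    using G_extrema by metis
  have "\<forall>\<^sub>F t in at_top. tail_volume t / t powr tail_exponent - G (ln t) < 1"
    using normalised_tail_limit by (intro order_tendstoD) auto
  then have "\<forall>\<^sub>F t in at_top. \<bar>tail_volume t\<bar> \<le> (M + 1) * t powr tail_exponent"
    using eventually_gt_at_top[of 0]
  proof eventually_elim
    case (elim t)
    have "G (ln t) \<le> M" using M by (simp add: has_maximum_def)
    with elim have "tail_volume t / t powr tail_exponent \<le> M + 1" by linarith
    then show ?case using elim(2) by (simp add: field_simps tail_volume_def)
  qed
  then show ?thesis using that[of "M + 1"] M by simp
qed

lemma tail_volume_lower_bound: obtains \<kappa> where "\<kappa> > 0" "\<forall>\<^sub>F t in at_top. \<kappa> * t powr tail_exponent \<le> tail_volume t"
proof -
  obtain m M where m: "has_minimum G m" "0 < m" "m < M"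
    using G_extrema by metis
  have "\<forall>\<^sub>F t in at_top. tail_volume t / t powr tail_exponent - G (ln t) > - (m / 2)"
    using normalised_tail_limit m by (intro order_tendstoD) auto
  then have "\<forall>\<^sub>F t in at_top. m / 2 * t powr tail_exponent \<le> tail_volume t"
    using eventually_gt_at_top[of 0]
  proof eventually_elim
    case (elim t)
    have "G (ln t) \<ge> m" using m by (simp add: has_minimum_def)
    with elim have "tail_volume t / t powr tail_exponent \<ge> m / 2" by linarith
    then show ?case using elim(2) by (simp add: field_simps)
  qed
  then show ?thesis using that[of "m / 2"] m by simp
qed

lemma content_above_D:
  assumes r: "r > D"
  shows "upper_Minkowski_content r \<Omega> = 0" "lower_Minkowski_content r \<Omega> = 0"
proof -
  obtain K where K: "\<forall>\<^sub>F t in at_top. \<bar>tail_volume t\<bar> \<le> K * t powr tail_exponent"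
    using tail_volume_upper_bound by metis
  have "((\<lambda>t. K * t powr (- (r - D))) \<longlongrightarrow> K * 0) at_top"
    by (intro tendsto_mult tendsto_const tendsto_neg_powr filterlim_ident) (use r in auto)
  then have lim0: "((\<lambda>t. K * t powr (- (r - D))) \<longlongrightarrow> 0) at_top" by simp
  have "\<forall>\<^sub>F t in at_top. norm (tail_volume t / t powr (real DIM('a) + r)) \<le> K * t powr (- (r - D))"
    using K eventually_gt_at_top[of 0]
  proof eventually_elim
    case (elim t)
    have "norm (tail_volume t / t powr (real DIM('a) + r)) \<le> K * t powr tail_exponent / t powr (real DIM('a) + r)"
      using elim by (simp add: divide_right_mono)
    also have "\<dots> = K * t powr (tail_exponent - (real DIM('a) + r))"
      by (simp add: powr_diff)
    finally show ?case by (simp add: tail_exponent_def)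
  qed
  then have "((\<lambda>t. tail_volume t / t powr (real DIM('a) + r)) \<longlongrightarrow> 0) at_top"
    by (rule Lim_null_comparison[OF _ lim0])
  then have "((\<lambda>t. ennreal (tail_volume t / t powr (real DIM('a) + r))) \<longlongrightarrow> 0) at_top"
    using tendsto_ennrealI by force
  then show "upper_Minkowski_content r \<Omega> = 0" "lower_Minkowski_content r \<Omega> = 0"
    unfolding content_eq by (auto intro!: lim_imp_Limsup lim_imp_Liminf)
qed

lemma content_below_D:
  assumes r: "r < D"
  shows "upper_Minkowski_content r \<Omega> = \<infinity>" "lower_Minkowski_content r \<Omega> = \<infinity>"
proof -
  obtain \<kappa> where \<kappa>: "\<kappa> > 0" "\<forall>\<^sub>F t in at_top. \<kappa> * t powr tail_exponent \<le> tail_volume t"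
    by (rule tail_volume_lower_bound)
  have ge: "ennreal B \<le> lower_Minkowski_content r \<Omega>" for B
    unfolding content_eq
  proof (rule Liminf_bounded)
    have "filterlim (\<lambda>t. \<kappa> * t powr (D - r)) at_top at_top"
      using r \<kappa>(1) by real_asymp
    then have "\<forall>\<^sub>F t in at_top. B \<le> \<kappa> * t powr (D - r)"
      by (simp add: filterlim_at_top)
    then show "\<forall>\<^sub>F t in at_top. ennreal B \<le> ennreal (tail_volume t / t powr (real DIM('a) + r))"
      using \<kappa>(2) eventually_gt_at_top[of 0]
    proof eventually_elim
      case (elim t)
      have "\<kappa> * t powr (D - r) = \<kappa> * t powr (tail_exponent - (real DIM('a) + r))"
        by (simp add: tail_exponent_def)
      also have "\<dots> = \<kappa> * t powr tail_exponent / t powr (real DIM('a) + r)"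
        by (simp add: powr_diff)
      also have "\<dots> \<le> tail_volume t / t powr (real DIM('a) + r)"
        using elim by (intro divide_right_mono) auto
      finally show ?case using elim(1) by (intro ennreal_leI) linarith
    qed
  qed
  show lower: "lower_Minkowski_content r \<Omega> = \<infinity>"
  proof (cases "lower_Minkowski_content r \<Omega>")
    case (real x)
    then show ?thesis using ge[of "x + 1"] by (simp add: ennreal_le_iff)
  qed simp
  have "lower_Minkowski_content r \<Omega> \<le> upper_Minkowski_content r \<Omega>"
    unfolding content_eq by (rule Liminf_le_Limsup) simp
  then show "upper_Minkowski_content r \<Omega> = \<infinity>"
    unfolding lower by (simp add: top_unique)
qed

lemma has_dim_D: "has_Minkowski_dim \<Omega> (ereal D)"
proof -
  obtain m M where mM: "has_minimum G m" "has_maximum G M" "0 < m" "m < M"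
    using G_extrema by metis
  have u0: "upper_Minkowski_content D \<Omega> \<noteq> 0" and l0: "lower_Minkowski_content D \<Omega> \<noteq> 0"
    using mM by (simp_all add: upper_content_D lower_content_D)
  have "{r. upper_Minkowski_content r \<Omega> = 0} = {D<..}"
  proof (intro set_eqI)
    fix r show "r \<in> {r. upper_Minkowski_content r \<Omega> = 0} \<longleftrightarrow> r \<in> {D<..}"
      using content_above_D(1)[of r] content_below_D(1)[of r] u0
      by (cases r D rule: linorder_cases) auto
  qed
  moreover have "{r. lower_Minkowski_content r \<Omega> = 0} = {D<..}"
  proof (intro set_eqI)
    fix r show "r \<in> {r. lower_Minkowski_content r \<Omega> = 0} \<longleftrightarrow> r \<in> {D<..}"
      using content_above_D(2)[of r] content_below_D(2)[of r] l0
      by (cases r D rule: linorder_cases) auto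
  qed
  ultimately show ?thesis
    by (simp add: has_Minkowski_dim_def upper_Minkowski_dim_def lower_Minkowski_dim_def
        Inf_ereal_greaterThan)
qed

lemma nondegenerate: "Minkowski_nondegenerate \<Omega>"
proof -
  obtain m M where mM: "has_minimum G m" "has_maximum G M" "0 < m" "m < M"
    using G_extrema by metis
  then show ?thesis
    unfolding Minkowski_nondegenerate_def
    by (intro exI[of _ D]) (simp add: upper_content_D lower_content_D ennreal_le_iff)
qed

text \<open>In orders other than \<open>D\<close> the contents are \<open>0\<close> or infinite, and in order \<open>D\<close> they are the distinct
extrema of \<open>G\<close>.\<close>

lemma not_measurable: "\<not> Minkowski_measurable \<Omega>"
proof
  assume "Minkowski_measurable \<Omega>"
  then obtain r where r: "0 < lower_Minkowski_content r \<Omega>"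
      "lower_Minkowski_content r \<Omega> = upper_Minkowski_content r \<Omega>" "upper_Minkowski_content r \<Omega> < \<infinity>"
    by (auto simp: Minkowski_measurable_def)
  obtain m M where mM: "has_minimum G m" "has_maximum G M" "0 < m" "m < M"
    using G_extrema by metis
  have "r = D"
    using r content_above_D[of r] content_below_D[of r] by (cases r D rule: linorder_cases) auto
  then show False using r(2) mM by (simp add: upper_content_D lower_content_D)
qed

text \<open>The mean over a period is strictly between the extrema because both are attained within one period
and they differ.\<close>

lemma mean_between:
  assumes "has_minimum G m" "has_maximum G M"
  shows "m < 1 / T * integral {0..T} G" "1 / T * integral {0..T} G < M"
proof -
  obtain m' M' where mM: "has_minimum G m'" "has_maximum G M'" "G ` {0..T} = {m'..M'}" "m' < M'"
    using G_extrema by metis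
  have eq: "m' = m" "M' = M"
    using assms mM(1,2) by (auto simp: has_minimum_def has_maximum_def intro: antisym)
  have "m \<in> G ` {0..T}" "M \<in> G ` {0..T}" using mM(3,4) by (auto simp: eq)
  then obtain x y where "x \<in> {0..T}" "G x = m" "y \<in> {0..T}" "G y = M" by auto
  then show "m < 1 / T * integral {0..T} G" "1 / T * integral {0..T} G < M"
    using mM(4) assms continuous_on_subset[OF continuous_G] unfolding eq
    by (intro continuous_mean_greater[OF T, of G m y] continuous_mean_less[OF T, of G M x];
        simp add: has_minimum_def has_maximum_def)+
qed

lemma tube_zeta_integrand_eq:
  "tube_zeta_integrand \<Omega> s = Mellin_kernel tail_volume (s + of_nat DIM('a))"
  by (intro ext) (simp add: tube_zeta_integrand_def Mellin_kernel_def tail_volume_def diff_diff_eq algebra_simps)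

lemma tube_zeta_eq: "tube_zeta P \<Omega> s = tail_Mellin P tail_volume (s + of_nat DIM('a))"
  by (simp add: tube_zeta_def tail_Mellin_def tube_zeta_integrand_eq)

lemma Re_shift: "tail_exponent < Re (s + of_nat DIM('a)) \<longleftrightarrow> D < Re s"
  by (auto simp: tail_exponent_def)

text \<open>The tail volume lies between two positive multiples of \<open>t powr tail_exponent\<close> for large \<open>t\<close>.\<close>

lemma tube_zeta_integrable_iff:
  assumes P: "P > 0"
  shows "set_integrable lborel {P..} (tube_zeta_integrand \<Omega> s) \<longleftrightarrow> D < Re s"
proof
  assume "D < Re s"
  obtain K where "\<forall>\<^sub>F t in at_top. \<bar>tail_volume t\<bar> \<le> K * t powr tail_exponent"
    using tail_volume_upper_bound by metis
  then obtain K' where "\<And>t. t \<ge> P \<Longrightarrow> \<bar>tail_volume t\<bar> \<le> K' * t powr tail_exponent"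
    using P by (elim eventually_powr_bound_extend[rotated 2]) (auto intro!: continuous_tail_volume)
  then show "set_integrable lborel {P..} (tube_zeta_integrand \<Omega> s)"
    unfolding tube_zeta_integrand_eq using P \<open>D < Re s\<close>
    by (intro set_integrable_Mellin_kernel[where C = K' and c = tail_exponent] continuous_tail_volume) (auto simp: tail_exponent_def)
next
  assume *: "set_integrable lborel {P..} (tube_zeta_integrand \<Omega> s)"
  obtain \<kappa> where "\<kappa> > 0" "\<forall>\<^sub>F t in at_top. \<kappa> * t powr tail_exponent \<le> tail_volume t"
    by (rule tail_volume_lower_bound)
  then show "D < Re s"
    using not_set_integrable_Mellin_kernel[of \<kappa> tail_exponent tail_volume "s + of_nat DIM('a)" P] *
    unfolding tube_zeta_integrand_eq Re_shift[symmetric] by (meson not_less)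
qed

lemma abscissa:
  assumes P: "P > 0"
  shows "tube_zeta_abscissa P \<Omega> = ereal D"
proof -
  have "(\<forall>s. \<sigma> < Re s \<longrightarrow> D < Re s) \<longleftrightarrow> D \<le> \<sigma>" for \<sigma>
  proof
    assume *: "\<forall>s. \<sigma> < Re s \<longrightarrow> D < Re s"
    show "D \<le> \<sigma>"
      using *[rule_format, of "of_real D"] by (cases "\<sigma> < D") auto
  qed auto
  then show ?thesis
    unfolding tube_zeta_abscissa_def tube_zeta_integrable_iff[OF P]
    using Inf_ereal_atLeast[of D] by (simp add: atLeast_def)
qed

text \<open>The numerator obtained by summing the geometric series for the leading part. The interval starts at
\<open>ln P\<close> rather than \<open>0\<close> because the tube zeta integral starts at \<open>P\<close>; at lattice points this shift has no
effect, since the integrand is periodic there.\<close>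

definition period_transform :: "real \<Rightarrow> complex \<Rightarrow> complex" where
  "period_transform P s = integral {ln P..ln P + T} (\<lambda>x. exp (- (s - of_real D) * of_real x) * of_real (G x))"

lemma holomorphic_period_transform: "period_transform P holomorphic_on UNIV"
proof -
  have "(\<lambda>s. integral {ln P..ln P + T} (\<lambda>x. exp (s * of_real (- x)) *
      (exp (of_real D * of_real x) * of_real (G x)))) holomorphic_on UNIV"
    by (intro holomorphic_on_compact_Laplace continuous_intros continuous_on_subset[OF continuous_G]) auto
  moreover have "exp (- (s - of_real D) * of_real x) * of_real (G x) = exp (s * of_real (- x)) *
      (exp (of_real D * of_real x) * of_real (G x))" for s :: complex and x :: real
    unfolding mult.assoc[symmetric] exp_add[symmetric] by (simp add: algebra_simps)
  ultimately show ?thesis unfolding period_transform_def[abs_def] by (simp only:)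
qed

text \<open>At a lattice point the exponential becomes a character of period \<open>T\<close>, so the integral does not depend
on which period it is taken over.\<close>

lemma period_transform_lattice_point: "period_transform P (lattice_point D T k) = Fourier_integral T (\<lambda>x. of_real (G x)) k"
proof -
  have "lattice_point D T k - of_real D = frequency T k"
    by (simp add: lattice_point_def frequency_def)
  then show ?thesis
    unfolding period_transform_def
    using Fourier_integral_over_period[of "\<lambda>x. of_real (G x)" T "ln P" k] per T continuous_G
    by (simp add: continuous_on_of_real)
qed

text \<open>The contribution of the remainder, which converges on the larger half-plane \<open>Re s > D - \<alpha>\<close>.\<close>

definition holomorphic_part :: "real \<Rightarrow> complex \<Rightarrow> complex" where
  "holomorphic_part P s = tail_Mellin P remainder (s + of_nat DIM('a))"

lemma remainder_global_bound:
  assumes "P > 0"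
  obtains C where "\<And>t. t \<ge> P \<Longrightarrow> \<bar>remainder t\<bar> \<le> C * t powr (tail_exponent - \<alpha>)"
proof -
  obtain C where "\<forall>\<^sub>F t in at_top. \<bar>remainder t\<bar> \<le> C * t powr (tail_exponent - \<alpha>)"
    by (rule remainder_bound)
  then show ?thesis
    using assms that
    by (elim eventually_powr_bound_extend[rotated 2]) (auto intro!: continuous_remainder)
qed

lemma holomorphic_holomorphic_part:
  assumes P: "P > 0"
  shows "holomorphic_part P holomorphic_on {s. D - \<alpha> < Re s}"
proof -
  obtain C where C: "\<And>t. t \<ge> P \<Longrightarrow> \<bar>remainder t\<bar> \<le> C * t powr (tail_exponent - \<alpha>)"
    using remainder_global_bound[OF P] by blast
  have "tail_Mellin P remainder holomorphic_on {s. tail_exponent - \<alpha> < Re s}"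
    using P by (intro holomorphic_tail_Mellin[OF P _ C] continuous_remainder) auto
  then have "(tail_Mellin P remainder \<circ> (\<lambda>s. s + of_nat DIM('a))) holomorphic_on {s. D - \<alpha> < Re s}"
    by (intro holomorphic_on_compose_gen[where t = "{s. tail_exponent - \<alpha> < Re s}"] holomorphic_intros)
       (auto simp: tail_exponent_def)
  then show ?thesis by (simp add: holomorphic_part_def[abs_def] o_def)
qed

text \<open>Both parts of the tail volume have convergent transforms for \<open>Re s > D\<close>. The right-hand side makes
sense on the larger half-plane \<open>Re s > D - \<alpha>\<close> and is the source of the meromorphic extension.\<close>

lemma tube_zeta_decomposition:
  assumes P: "P > 0" and s: "D < Re s"
  shows "tube_zeta P \<Omega> s = holomorphic_part P s + period_transform P s / (1 - exp (- of_real T * (s - of_real D)))"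
proof -
  define z where "z = s + of_nat DIM('a)"
  have z: "tail_exponent < Re z" "tail_exponent - \<alpha> < Re z" using s \<alpha> by (auto simp: z_def tail_exponent_def)
  have zc: "z - of_real tail_exponent = s - of_real D" by (simp add: z_def tail_exponent_def)
  obtain C where C: "\<And>t. t \<ge> P \<Longrightarrow> \<bar>remainder t\<bar> \<le> C * t powr (tail_exponent - \<alpha>)"
    using remainder_global_bound[OF P] by blast
  have int_rem: "set_integrable lborel {P..} (Mellin_kernel remainder z)"
    using P by (intro set_integrable_Mellin_kernel[OF P _ C z(2)] continuous_remainder) auto
  have "set_integrable lborel {P..} (Mellin_kernel tail_volume z)"
    using tube_zeta_integrable_iff[OF P, of s] s by (simp add: tube_zeta_integrand_eq z_def)
  then have "set_integrable lborel {P..} (\<lambda>t. Mellin_kernel tail_volume z t - Mellin_kernel remainder z t)"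
    using int_rem by (rule set_integral_diff)
  moreover have split: "Mellin_kernel tail_volume z t - Mellin_kernel remainder z t = Mellin_kernel leading z t" for t
    by (simp add: Mellin_kernel_def remainder_def algebra_simps)
  ultimately have int_lead: "set_integrable lborel {P..} (Mellin_kernel leading z)"
    by simp
  have "tail_Mellin P tail_volume z = tail_Mellin P remainder z + tail_Mellin P leading z"
    unfolding tail_Mellin_def set_integral_add(2)[OF int_rem int_lead, symmetric]
    by (simp add: split[symmetric])
  moreover have "(1 - exp (- of_real T * (s - of_real D))) * tail_Mellin P leading z = period_transform P s"
    using log_periodic_tail_Mellin[OF P T continuous_G per int_lead[unfolded leading_def[abs_def]]]
    by (simp add: leading_def[abs_def] zc period_transform_def)
  moreover have "exp (- of_real T * (s - of_real D)) \<noteq> 1"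
  proof -
    have "Re (lattice_point D T k) = D" for k by (simp add: lattice_point_def)
    then show ?thesis
      using s exp_eq_1_iff_lattice_point[OF T, of s D] by auto
  qed
  ultimately show ?thesis
    unfolding tube_zeta_eq z_def[symmetric] holomorphic_part_def by (simp add: field_simps)
qed

end

section \<open>Minkowski content and tube zeta function at infinity\<close>

theorem theorem3p12:
  fixes \<Omega> :: "'a::euclidean_space set"
    and D \<alpha> T P :: real
    and G :: "real \<Rightarrow> real"
  assumes "\<Omega> \<in> lmeasurable"
    and "D < - real DIM('a)"
    and "\<alpha> > 0"
    and "P > 0"
    and "\<forall>\<tau>. G \<tau> > 0"
    and "\<not> G constant_on UNIV"
    and "is_minimal_period G T"
    and "\<exists>E. E \<in> O[at_top](\<lambda>t. t powr (- \<alpha>)) \<and>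
          (\<forall>\<^sub>F t in at_top. measure lebesgue (tail_at t \<Omega>)
                             = t powr (real DIM('a) + D) * (G (ln t) + E t))"
  shows
    "continuous_on UNIV G \<and>
     has_Minkowski_dim \<Omega> (ereal D) \<and>
     Minkowski_nondegenerate \<Omega> \<and>
     (\<exists>m M. has_minimum G m \<and> has_maximum G M \<and>
        lower_Minkowski_content D \<Omega> = ennreal m \<and>
        upper_Minkowski_content D \<Omega> = ennreal M) \<and>
     (\<lambda>\<tau>. ennreal (G \<tau>)) ` {0..T}
        = {lower_Minkowski_content D \<Omega>..upper_Minkowski_content D \<Omega>} \<and>
     tube_zeta_abscissa P \<Omega> = ereal D \<and>
     (let A = {s. tube_zeta_abscissa P \<Omega> < ereal (Re s)};
          U = {s. Re s > D - \<alpha>};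
          s = lattice_point D T;
          Ghat = (\<lambda>k::int. Fourier (truncated T G) (of_real (of_int k / T)))
      in
      \<exists>Z. is_meromorphic_extension (tube_zeta P \<Omega>) A Z U \<and>
         (\<forall>Z'. is_meromorphic_extension (tube_zeta P \<Omega>) A Z' U \<longrightarrow> (\<forall>w\<in>U. Z' w = Z w)) \<and>
         poles_in Z U = {s k | k. Ghat k \<noteq> 0} \<and>
         (\<forall>w \<in> poles_in Z U. zorder Z w = - 1) \<and>
         (\<forall>k. s k \<in> poles_in Z U \<longrightarrow> residue Z (s k) = of_real (1 / T) * Ghat k) \<and>

         (\<forall>k. s k \<in> poles_in Z U \<longrightarrow>
            s (- k) \<in> poles_in Z U \<and>
            norm (residue Z (s k)) \<le> 1 / T * integral {0..T} G) \<and>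
         ((\<lambda>k. residue Z (s k)) \<longlongrightarrow> 0) at_top \<and>
         ((\<lambda>k. residue Z (s k)) \<longlongrightarrow> 0) at_bot \<and>

         s 0 = of_real D \<and>
         of_real D \<in> poles_in Z U \<and>
         residue Z (of_real D) = of_real (1 / T * integral {0..T} G) \<and>
         \<not> Minkowski_measurable \<Omega> \<and>
         lower_Minkowski_content D \<Omega> < ennreal (Re (residue Z (of_real D))) \<and>
         ennreal (Re (residue Z (of_real D))) < upper_Minkowski_content D \<Omega> \<and>
         upper_Minkowski_content D \<Omega> < \<infinity> \<and>

         (\<forall>m\<ge>1. \<forall>t0. C_class m G \<and> local_extremum_at G t0 \<and>
              (\<forall>j\<in>{1..m}. (deriv ^^ j) G t0 = 0) \<longrightarrow>
            (\<exists>C>0. \<forall>k. k \<noteq> 0 \<and> s k \<in> poles_in Z U \<longrightarrow>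
               norm (residue Z (s k)) \<le> C * \<bar>real_of_int k\<bar> powi (- int m))))"
proof -
  have T: "T > 0" and per: "\<And>x. G (x + T) = G x"
    using assms(7) by (auto simp: is_minimal_period_def)
  interpret log_periodic_tail \<Omega> D \<alpha> T G
    using assms T per by unfold_locales auto
  have P: "P > 0" by fact
  obtain m M where mM: "has_minimum G m" "has_maximum G M" "G ` {0..T} = {m..M}" "0 < m" "m < M"
    by (rule G_extrema)
  note lower = lower_content_D[OF mM(1)] and upper = upper_content_D[OF mM(2)]
  have range: "(\<lambda>\<tau>. ennreal (G \<tau>)) ` {0..T} = {ennreal m..ennreal M}"
  proof -
    have "ennreal ` {m..M} = {ennreal m..ennreal M}"
    proof (intro set_eqI iffI)
      fix y assume y: "y \<in> {ennreal m..ennreal M}"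
      then have "y \<noteq> top" by (auto simp: top_unique)
      then obtain r where r: "y = ennreal r" "r \<ge> 0" by (cases y) auto
      with y mM(4,5) have "r \<in> {m..M}" by (auto simp: ennreal_le_iff)
      with r show "y \<in> ennreal ` {m..M}" by blast
    qed (use mM(4) in \<open>auto intro: ennreal_leI\<close>)
    then show ?thesis unfolding mM(3)[symmetric] by (simp add: image_image)
  qed
  define U where "U = {s. D - \<alpha> < Re s}"
  define A where "A = {s. tube_zeta_abscissa P \<Omega> < ereal (Re s)}"
  define s where "s = lattice_point D T"
  define Ghat where "Ghat = (\<lambda>k::int. Fourier (truncated T G) (of_real (of_int k / T)))"
  define mean where "mean = 1 / T * integral {0..T} G"
  have A: "A = {s. D < Re s}" by (simp add: A_def abscissa[OF P])
  have Ghat: "Ghat k = Fourier_integral T (\<lambda>x. of_real (G x)) k" for k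
    by (simp add: Ghat_def Fourier_truncated_eq[OF T continuous_G, simplified])
  have s_in_U: "s k \<in> U" for k
    using \<alpha> by (simp add: s_def U_def lattice_point_def)
  have opens: "open U" "connected U" "open A" "A \<noteq> {}" "A \<subseteq> U"
  proof -
    show "open U" "open A" by (simp_all add: U_def A open_halfspace_Re_gt)
    show "connected U" by (simp add: U_def convex_connected convex_halfspace_Re_gt)
    have "of_real (D + 1) \<in> A" by (simp add: A)
    then show "A \<noteq> {}" by blast
    show "A \<subseteq> U" using \<alpha> by (auto simp: A U_def)
  qed
  define Z where "Z = remove_sings
    (\<lambda>s. holomorphic_part P s + period_transform P s / (1 - exp (- of_real T * (s - of_real D))))"
  note Z_facts = lattice_quotient_meromorphic[OF opens(1) holomorphic_on_subset[OF holomorphic_period_transform[of P] subset_UNIV]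
      holomorphic_holomorphic_part[OF P, folded U_def] T, where D = D, folded Z_def s_def]
  have ext: "is_meromorphic_extension (tube_zeta P \<Omega>) A Z U"
    unfolding is_meromorphic_extension_def
  proof (intro conjI ballI opens Z_facts(1))
    fix w assume w: "w \<in> A"
    then have "\<nexists>k. w = s k" by (auto simp: A s_def lattice_point_def)
    then show "Z w = tube_zeta P \<Omega> w"
      using w opens(5) Z_facts(2)[of w] tube_zeta_decomposition[OF P, of w] by (auto simp: A)
  qed
  have transform_s: "period_transform P (s k) = Ghat k" for k
    by (simp add: s_def period_transform_lattice_point Ghat)
  have poles: "poles_in Z U = {s k | k. Ghat k \<noteq> 0}"
    unfolding Z_facts(3) by (auto simp: transform_s s_in_U)
  have res: "residue Z (s k) = of_real (1 / T) * Ghat k" for k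
    using Z_facts(5)[OF s_in_U, of k] by (simp add: transform_s)
  have s_inj: "s j = s k \<longleftrightarrow> j = k" for j k
    using T by (auto simp: s_def lattice_point_def)
  have pole_iff: "s k \<in> poles_in Z U \<longleftrightarrow> Ghat k \<noteq> 0" for k
    by (auto simp: poles s_inj)
  have s0: "s 0 = of_real D" by (simp add: s_def lattice_point_def)
  have Ghat0: "Ghat 0 = of_real (integral {0..T} G)"
    by (simp add: Ghat Fourier_integral_0[OF continuous_G])
  have mean: "m < mean" "mean < M"
    unfolding mean_def by (rule mean_between[OF mM(1,2)])+
  have resD: "residue Z (of_real D) = of_real mean"
    using res[of 0] by (simp add: s0 Ghat0 mean_def)
  have "Ghat 0 \<noteq> 0"
    using mean(1) mM(4) T by (auto simp: Ghat0 mean_def)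
  then have poleD: "of_real D \<in> poles_in Z U"
    using pole_iff[of 0] by (simp add: s0)
  have Ghat_minus: "Ghat (- k) = cnj (Ghat k)" for k
    by (simp add: Ghat Fourier_integral_uminus)
  have G_int: "norm (complex_of_real (G x)) = G x" for x
    using G_pos[of x] by simp
  have res_le: "norm (residue Z (s k)) \<le> 1 / T * integral {0..T} G" for k
    using norm_Fourier_integral_le[OF continuous_on_of_real[OF continuous_G], of T k] T
    unfolding res Ghat G_int by (simp add: norm_mult norm_divide divide_right_mono)
  have res_lim: "((\<lambda>k. residue Z (s k)) \<longlongrightarrow> 0) F" if "F = at_top \<or> F = at_bot" for F
  proof -
    have "((\<lambda>k. of_real (1 / T) * Ghat k) \<longlongrightarrow> of_real (1 / T) * 0) F"
      unfolding Ghat using that per T continuous_G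
        Riemann_Lebesgue_periodic[of "\<lambda>x. complex_of_real (G x)" T]
      by (intro tendsto_mult_left) auto
    then show ?thesis by (simp add: res)
  qed
  have smooth: "\<exists>C>0. \<forall>k. k \<noteq> 0 \<and> s k \<in> poles_in Z U \<longrightarrow>
      norm (residue Z (s k)) \<le> C * \<bar>real_of_int k\<bar> powi (- int n)" if C: "C_class n G" for n
  proof -
    obtain B where B: "B > 0" "\<And>k. k \<noteq> 0 \<Longrightarrow>
        norm (Fourier_integral T (\<lambda>x. of_real (G x)) k) \<le> B * \<bar>real_of_int k\<bar> powi (- int n)"
      using Fourier_integral_smooth_decay[of G, OF per T C] by metis
    have "norm (residue Z (s k)) \<le> B / T * \<bar>real_of_int k\<bar> powi (- int n)" if "k \<noteq> 0" for k
      using B(2)[OF that] T unfolding res Ghat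
      by (simp add: norm_mult norm_divide divide_right_mono)
    then show ?thesis using B(1) T by (intro exI[of _ "B / T"]) auto
  qed
  have analytic_part: "is_meromorphic_extension (tube_zeta P \<Omega>) A Z U \<and>
         (\<forall>Z'. is_meromorphic_extension (tube_zeta P \<Omega>) A Z' U \<longrightarrow> (\<forall>w\<in>U. Z' w = Z w)) \<and>
         poles_in Z U = {s k | k. Ghat k \<noteq> 0} \<and>
         (\<forall>w \<in> poles_in Z U. zorder Z w = - 1) \<and>
         (\<forall>k. s k \<in> poles_in Z U \<longrightarrow> residue Z (s k) = of_real (1 / T) * Ghat k) \<and>
         (\<forall>k. s k \<in> poles_in Z U \<longrightarrow>
            s (- k) \<in> poles_in Z U \<and>
            norm (residue Z (s k)) \<le> 1 / T * integral {0..T} G) \<and>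
         ((\<lambda>k. residue Z (s k)) \<longlongrightarrow> 0) at_top \<and>
         ((\<lambda>k. residue Z (s k)) \<longlongrightarrow> 0) at_bot \<and>
         s 0 = of_real D \<and>
         of_real D \<in> poles_in Z U \<and>
         residue Z (of_real D) = of_real (1 / T * integral {0..T} G) \<and>
         \<not> Minkowski_measurable \<Omega> \<and>
         lower_Minkowski_content D \<Omega> < ennreal (Re (residue Z (of_real D))) \<and>
         ennreal (Re (residue Z (of_real D))) < upper_Minkowski_content D \<Omega> \<and>
         upper_Minkowski_content D \<Omega> < \<infinity> \<and>
         (\<forall>m\<ge>1. \<forall>t0. C_class m G \<and> local_extremum_at G t0 \<and>
              (\<forall>j\<in>{1..m}. (deriv ^^ j) G t0 = 0) \<longrightarrow>
            (\<exists>C>0. \<forall>k. k \<noteq> 0 \<and> s k \<in> poles_in Z U \<longrightarrow>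
               norm (residue Z (s k)) \<le> C * \<bar>real_of_int k\<bar> powi (- int m)))"
  proof (intro conjI allI impI ballI)
    fix Z' w assume "is_meromorphic_extension (tube_zeta P \<Omega>) A Z' U" "w \<in> U"
    then show "Z' w = Z w"
      by (intro nicely_meromorphic_extension_unique[OF ext _ opens(3,4,1,2)])
  next
    fix k assume "s k \<in> poles_in Z U"
    then show "s (- k) \<in> poles_in Z U" by (simp add: pole_iff Ghat_minus)
  next
    show "lower_Minkowski_content D \<Omega> < ennreal (Re (residue Z (of_real D)))"
      "ennreal (Re (residue Z (of_real D))) < upper_Minkowski_content D \<Omega>"
      using mean mM(4) by (simp_all add: lower upper resD ennreal_less_iff)
  next
    show "upper_Minkowski_content D \<Omega> < \<infinity>" by (simp add: upper)
  next
    fix n :: nat and t0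
    assume "C_class n G \<and> local_extremum_at G t0 \<and> (\<forall>j\<in>{1..n}. (deriv ^^ j) G t0 = 0)"
    then show "\<exists>C>0. \<forall>k. k \<noteq> 0 \<and> s k \<in> poles_in Z U \<longrightarrow>
        norm (residue Z (s k)) \<le> C * \<bar>real_of_int k\<bar> powi (- int n)"
      by (intro smooth) simp
  qed (use ext poles Z_facts(4) res res_le res_lim s0 poleD resD not_measurable in \<open>simp_all add: mean_def\<close>)
  have extrema: "\<exists>m M. has_minimum G m \<and> has_maximum G M \<and>
      lower_Minkowski_content D \<Omega> = ennreal m \<and> upper_Minkowski_content D \<Omega> = ennreal M"
    using mM(1,2) lower upper by blast
  show ?thesis
    unfolding Let_def
    by (rule conjI[OF continuous_G conjI[OF has_dim_D conjI[OF nondegenerate conjI[OF extrema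
            conjI[OF range[folded lower upper] conjI[OF abscissa[OF P]]]]]]],
        rule exI[of _ Z], rule analytic_part[unfolded A_def U_def s_def Ghat_def])
qed

end
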